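(* There exist closed topological $4$-manifolds that do not admit any topological symplectic structure.
   Context: A symplectic homeomorphism between open subsets of $\mathbb{R}^{2n}$ (with the standard symplectic form) is a homeomorphism which is locally the $C^0$-limit of symplectic diffeomorphisms (i.e. each point of the domain has a neighborhood on which the map is a uniform limit of symplectic diffeomorphisms onto open subsets of $\mathbb{R}^{2n}$). A topological symplectic structure on a topological $2n$-manifold is an atlas of charts to $\mathbb{R}^{2n}$ whose transition maps are symplectic homeomorphisms. A closed manifold is a compact manifold without boundary. *)

theory Defs
  imports "HOL-Analysis.Analysis"
begin

section \<open>Topological manifolds\<close>

definition topological_manifold :: "nat \<Rightarrow> 'a topology \<Rightarrow> bool" where
  "topological_manifold n X \<longleftrightarrow>
     Hausdorff_space X \<and> second_countable X \<and>
     (\<forall>x\<in>topspace X. \<exists>U V. openin X U \<and> x \<in> U \<and> openin (Euclidean_space n) V \<and>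
        subtopology X U homeomorphic_space subtopology (Euclidean_space n) V)"

text \<open>Charts are modelled on the whole Euclidean space, so there is no boundary.\<close>

definition closed_manifold :: "nat \<Rightarrow> 'a topology \<Rightarrow> bool" where
  "closed_manifold n X \<longleftrightarrow> topological_manifold n X \<and> compact_space X"

section \<open>Symplectic diffeomorphisms and symplectic homeomorphisms\<close>

text \<open>On an open set, being of class $C^k$ is expressed through the directional
  derivatives. Because total differentiability is required at each stage,
  this agrees with continuity of the $k$-th Frechet derivative.\<close>

fun Ck_on :: "nat \<Rightarrow> 'a::euclidean_space set \<Rightarrow> ('a \<Rightarrow> 'b::euclidean_space) \<Rightarrow> bool" where
  "Ck_on 0 U f \<longleftrightarrow> continuous_on U f"
| "Ck_on (Suc k) U f \<longleftrightarrow>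
     (\<forall>x\<in>U. f differentiable at x) \<and>
     (\<forall>v. Ck_on k U (\<lambda>x. frechet_derivative f (at x) v))"

definition smooth_on :: "'a::euclidean_space set \<Rightarrow> ('a \<Rightarrow> 'b::euclidean_space) \<Rightarrow> bool" where
  "smooth_on U f \<longleftrightarrow> (\<forall>k. Ck_on k U f)"

definition diffeomorphism_between ::
    "'a::euclidean_space set \<Rightarrow> 'b::euclidean_space set \<Rightarrow> ('a \<Rightarrow> 'b) \<Rightarrow> bool" where
  "diffeomorphism_between U V f \<longleftrightarrow>
     open U \<and> open V \<and> smooth_on U f \<and>
     (\<exists>g. homeomorphism U V f g \<and> smooth_on V g)"

text \<open>The standard form \<open>\<Sum>\<^sub>i dx\<^sub>i \<and> dy\<^sub>i\<close> on the space of pairs \<open>(x, y)\<close>,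
  of real dimension \<open>2 * CARD('n)\<close>.\<close>

definition std_symplectic_form ::
    "(real^'n) \<times> (real^'n) \<Rightarrow> (real^'n) \<times> (real^'n) \<Rightarrow> real" where
  "std_symplectic_form v w = fst v \<bullet> snd w - snd v \<bullet> fst w"

definition symplectic_diffeomorphism ::
    "((real^'n) \<times> (real^'n)) set \<Rightarrow> ((real^'n) \<times> (real^'n)) set \<Rightarrow>
     ((real^'n) \<times> (real^'n) \<Rightarrow> (real^'n) \<times> (real^'n)) \<Rightarrow> bool" where
  "symplectic_diffeomorphism U V f \<longleftrightarrow>
     diffeomorphism_between U V f \<and>
     (\<forall>x\<in>U. \<forall>v w. std_symplectic_form (frechet_derivative f (at x) v)
                                     (frechet_derivative f (at x) w)
                 = std_symplectic_form v w)"

definition symplectic_homeomorphism ::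
    "((real^'n) \<times> (real^'n)) set \<Rightarrow> ((real^'n) \<times> (real^'n)) set \<Rightarrow>
     ((real^'n) \<times> (real^'n) \<Rightarrow> (real^'n) \<times> (real^'n)) \<Rightarrow> bool" where
  "symplectic_homeomorphism U V f \<longleftrightarrow>
     open U \<and> open V \<and> (\<exists>g. homeomorphism U V f g) \<and>
     (\<forall>x\<in>U. \<exists>W. open W \<and> x \<in> W \<and> W \<subseteq> U \<and>
        (\<exists>\<phi> :: nat \<Rightarrow> _. (\<forall>k. \<exists>V'. symplectic_diffeomorphism W V' (\<phi> k)) \<and>
             uniform_limit W \<phi> f sequentially))"

section \<open>Topological symplectic structures\<close>

text \<open>A chart is a pair \<open>(U, \<phi>)\<close> in which only the values of \<open>\<phi>\<close> on \<open>U\<close> matter.\<close>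

definition is_chart ::
    "'a topology \<Rightarrow> 'a set \<times> ('a \<Rightarrow> 'b::euclidean_space) \<Rightarrow> bool" where
  "is_chart X = (\<lambda>(U, \<phi>). openin X U \<and> open (\<phi> ` U) \<and>
     homeomorphic_map (subtopology X U) (top_of_set (\<phi> ` U)) \<phi>)"

definition transition_map ::
    "'a set \<times> ('a \<Rightarrow> 'b) \<Rightarrow> 'a set \<times> ('a \<Rightarrow> 'b) \<Rightarrow> 'b \<Rightarrow> 'b" where
  "transition_map c d = snd d \<circ> inv_into (fst c) (snd c)"

definition topological_symplectic_structure ::
    "'a topology \<Rightarrow> ('a set \<times> ('a \<Rightarrow> (real^'n) \<times> (real^'n))) set \<Rightarrow> bool" where
  "topological_symplectic_structure X \<A> \<longleftrightarrow>
     (\<forall>c\<in>\<A>. is_chart X c) \<and>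
     topspace X = (\<Union>c\<in>\<A>. fst c) \<and>
     (\<forall>c\<in>\<A>. \<forall>d\<in>\<A>.
        symplectic_homeomorphism (snd c ` (fst c \<inter> fst d)) (snd d ` (fst c \<inter> fst d))
          (transition_map c d))"

end

theory Submission
  imports Defs "HOL-Homology.Homology"
begin

text \<open>A non-orientable closed manifold, the product of the Klein bottle and a 2-torus, will do,
  because symplectic homeomorphisms preserve orientation. The orientation character of an
  injective continuous map \<open>f\<close> at \<open>x\<close> is the homotopy class of \<open>u \<mapsto> f (x + r u) - f x\<close>, as a
  map from the unit sphere to the punctured space. It is locally constant in \<open>x\<close>, stable under
  uniform limits, and given by the derivative for a diffeomorphism; a linear symplectic map is
  homotopic to the identity. Pulling the charts of a topological symplectic structure back to the
  universal cover therefore gives one and the same class at all points, in particular at two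
  points exchanged by an orientation-reversing deck transformation. So the class of a local
  homeomorphism would be invariant under a reflection, which has Brouwer degree \<open>-1\<close>.\<close>

section \<open>Reflections of the sphere\<close>

definition reflect :: "'a::real_inner \<Rightarrow> 'a \<Rightarrow> 'a" where
  "reflect e u = u - (2 * (u \<bullet> e)) *\<^sub>R e"

lemma norm_reflect:
  assumes "norm e = 1"
  shows "norm (reflect e u) = norm u"
proof -
  have "e \<bullet> e = 1" using assms by (simp add: norm_eq_1)
  then have "reflect e u \<bullet> reflect e u = u \<bullet> u"
    by (simp add: reflect_def algebra_simps inner_diff_left inner_diff_right inner_commute)
  then show ?thesis by (simp add: norm_eq_sqrt_inner)
qed

lemma reflect_reflect:
  assumes "norm e = 1"
  shows "reflect e (reflect e u) = u"
proof -
  have "e \<bullet> e = 1" using assms by (simp add: norm_eq_1)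
  then show ?thesis by (simp add: reflect_def inner_diff_left algebra_simps)
qed

lemma linear_reflect: "linear (reflect e)"
  by (rule linearI) (simp_all add: reflect_def inner_add_left algebra_simps)

text \<open>An orthonormal basis starting with \<open>e\<close> turns the unit sphere into
  \<open>nsphere n\<close> and \<open>reflect e\<close> into the sign change of coordinate 0. The
  latter has degree -1, the identity has degree 1, and the degree is a homotopy invariant.\<close>

lemma reflect_not_homotopic_id:
  fixes e :: "'a::euclidean_space"
  assumes e: "e \<in> Basis"
  shows "\<not> homotopic_with_canon (\<lambda>_. True) (sphere 0 1) (- {0})
           (\<lambda>u. u) (reflect e)"
proof
  assume hom: "homotopic_with_canon (\<lambda>_. True) (sphere 0 1) (- {0})
           (\<lambda>u. u) (reflect e)"
  define n where "n = DIM('a) - 1"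
  have card: "card (Basis - {e}) = n" using e by (simp add: n_def)
  obtain b0 where b0: "bij_betw b0 {1..n} (Basis - {e})"
    using card finite_same_card_bij[of "{1..n}" "Basis - {e}"] by auto
  \<comment> \<open>Index 0 is reserved for \<open>e\<close>, because the known degree is that of
    the reflection in coordinate 0.\<close>
  define b where "b = (\<lambda>i::nat. if i = 0 then e else b0 i)"
  have "{..n} = insert 0 {1..n}" by auto
  moreover have "bij_betw b {1..n} (Basis - {e})"
    using b0 by (rule bij_betw_cong[THEN iffD1, rotated]) (simp add: b_def)
  moreover have "bij_betw b {0} {e}" by (simp add: b_def bij_betw_def)
  ultimately have bij: "bij_betw b {..n} Basis"
    using bij_betw_combine[of b "{0}" "{e}" "{1..n}" "Basis - {e}"] e by (simp add: insert_absorb)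
  have inj: "inj_on b {..n}" and im: "b ` {..n} = Basis"
    using bij by (auto simp: bij_betw_def)
  have ib: "b i \<bullet> b j = (if i = j then 1 else 0)" if "i \<le> n" "j \<le> n" for i j
  proof -
    have "b i \<in> Basis" "b j \<in> Basis" using that im by auto
    moreover have "b i = b j \<longleftrightarrow> i = j" using that inj by (auto simp: inj_on_def)
    ultimately show ?thesis by (simp add: inner_Basis)
  qed
  \<comment> \<open>The points of \<open>nsphere n\<close> are sequences vanishing beyond
    \<open>n\<close>, hence the value 0 there.\<close>
  define F where "F = (\<lambda>(x::'a) i. if i \<le> n then x \<bullet> b i else 0)"
  define G where "G = (\<lambda>y :: nat \<Rightarrow> real. (\<Sum>i\<le>n. y i *\<^sub>R b i))"
  have Gb: "G y \<bullet> b j = y j" if "j \<le> n" for y j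
    using that by (simp add: G_def inner_sum_left ib if_distrib cong: if_cong)
  have normF: "(\<Sum>i\<le>n. (F x i)\<^sup>2) = (norm x)\<^sup>2" for x
    unfolding F_def using sum.reindex_bij_betw[OF bij, of "\<lambda>b. (x \<bullet> b)\<^sup>2"]
    by (simp add: norm_eq_sqrt_inner euclidean_inner[of x x] power2_eq_square sum_nonneg)
  have FG: "F (G y) = y" if "y \<in> topspace (nsphere n)" for y
    using that Gb by (auto simp: F_def fun_eq_iff nsphere)
  have normG: "norm (G y) = 1" if "y \<in> topspace (nsphere n)" for y
    using normF[of "G y"] FG[OF that] that norm_ge_zero[of "G y"]
    by (auto simp: nsphere abs_square_eq_1 power2_eq_1_iff)
  have contG: "continuous_map (nsphere n) (top_of_set (sphere 0 1)) G"
  proof -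
    have "continuous_map (nsphere n) euclidean (\<lambda>y. y i *\<^sub>R b i)" for i
      using continuous_map_compose[OF continuous_map_nsphere_projection[of n i],
          of euclidean "\<lambda>r. r *\<^sub>R b i"]
      by (simp add: o_def continuous_intros)
    then have "continuous_map (nsphere n) euclidean G"
      unfolding G_def by (intro continuous_map_sum) auto
    then show ?thesis using normG by (auto simp: continuous_map_in_subtopology)
  qed
  \<comment> \<open>Radial projection turns the homotopy through the punctured space into one of
    self-maps of the sphere, for which a degree is defined.\<close>
  define N where "N = (\<lambda>x::'a. x /\<^sub>R norm x)"
  have contF: "continuous_map (top_of_set (- {0})) (nsphere n) (F \<circ> N)"
  proof -
    have "continuous_on (- {0}) (\<lambda>x. inverse (norm x) * (x \<bullet> b i))" for i
      by (auto intro!: continuous_intros)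
    moreover have "(\<Sum>i\<le>n. (F (N x) i)\<^sup>2) = 1" if "x \<noteq> 0" for x
      using that by (simp add: normF N_def)
    ultimately show ?thesis
      unfolding nsphere continuous_map_in_subtopology continuous_map_componentwise_UNIV
      by (auto simp: F_def N_def)
  qed
  have "homotopic_with (\<lambda>_. True) (nsphere n) (nsphere n)
          ((F \<circ> N) \<circ> ((\<lambda>u. u) \<circ> G)) ((F \<circ> N) \<circ> (reflect e \<circ> G))"
    using homotopic_with_compose_continuous_map_left[OF
        homotopic_with_compose_continuous_map_right[OF hom contG, where q="\<lambda>_. True"] contF] by simp
  then have deg: "Brouwer_degree2 n ((F \<circ> N) \<circ> ((\<lambda>u. u) \<circ> G))
      = Brouwer_degree2 n ((F \<circ> N) \<circ> (reflect e \<circ> G))"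
    by (rule Brouwer_degree2_homotopic)
  have "Brouwer_degree2 n ((F \<circ> N) \<circ> ((\<lambda>u. u) \<circ> G)) = Brouwer_degree2 n id"
    using FG normG by (intro Brouwer_degree2_eq) (simp add: N_def)
  moreover have "Brouwer_degree2 n ((F \<circ> N) \<circ> (reflect e \<circ> G))
     = Brouwer_degree2 n (\<lambda>x i. if i = 0 then - x i else x i)"
  proof (rule Brouwer_degree2_eq)
    fix y assume y: "y \<in> topspace (nsphere n)"
    have "norm (reflect e (G y)) = 1" using normG[OF y] e by (simp add: norm_reflect)
    moreover have "e = b 0" by (simp add: b_def)
    moreover have "y i = 0" if "i > n" for i using y that by (simp add: nsphere)
    ultimately show "((F \<circ> N) \<circ> (reflect e \<circ> G)) y = (\<lambda>i. if i = 0 then - y i else y i)"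
      by (auto simp: fun_eq_iff N_def F_def reflect_def inner_diff_left Gb ib not_le)
  qed
  ultimately show False
    using deg by (simp add: Brouwer_degree2_reflection)
qed

section \<open>Linear symplectic maps\<close>

text \<open>Multiplication by the imaginary unit when \<open>(x, y)\<close> is read as
  \<open>x + i y\<close>.\<close>

definition cstr :: "(real^'n) \<times> (real^'n) \<Rightarrow> (real^'n) \<times> (real^'n)" where
  "cstr v = (- snd v, fst v)"

lemma linear_cstr: "linear cstr"
  by (rule linearI) (auto simp: cstr_def)

lemma cstr_cstr [simp]: "cstr (cstr v) = - v"
  by (simp add: cstr_def prod_eq_iff)

lemma std_symplectic_form_cstr: "std_symplectic_form v (cstr v) = v \<bullet> v"
  by (cases v) (simp add: std_symplectic_form_def cstr_def)

text \<open>For symplectic \<open>S\<close> the midpoint \<open>(S - J S J) / 2\<close> of \<open>S\<close> and its conjugate is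
  complex linear, and no point of the segment between the two is singular, because
  the form is positive on every \<open>(v, J v)\<close>.\<close>

lemma symplectic_segment_complex_linear:
  fixes S :: "(real^'n) \<times> (real^'n) \<Rightarrow> (real^'n) \<times> (real^'n)"
  assumes S: "linear S"
    and symp: "\<And>v w. std_symplectic_form (S v) (S w) = std_symplectic_form v w"
    and v: "v \<noteq> 0"
    and t: "0 \<le> t" "t \<le> 1"
  shows "(1 - t) *\<^sub>R S v - t *\<^sub>R cstr (S (cstr v)) \<noteq> 0"
proof
  assume "(1 - t) *\<^sub>R S v - t *\<^sub>R cstr (S (cstr v)) = 0"
  then have eq: "t *\<^sub>R cstr (S (cstr v)) = (1 - t) *\<^sub>R S v" by simp
  then have "t *\<^sub>R cstr (cstr (S (cstr v))) = (1 - t) *\<^sub>R cstr (S v)"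
    by (simp only: linear_cmul[OF linear_cstr, symmetric])
  then have "- (t *\<^sub>R S (cstr v)) = (1 - t) *\<^sub>R cstr (S v)"
    by (simp only: cstr_cstr scaleR_minus_right)
  then have eq2: "t *\<^sub>R S (cstr v) = (- (1 - t)) *\<^sub>R cstr (S v)"
    by (simp only: minus_equation_iff[of "t *\<^sub>R S (cstr v)"] scaleR_minus_left)
  have pos: "std_symplectic_form (S v) (S (cstr v)) > 0"
    using v by (simp add: symp std_symplectic_form_cstr)
  have scale: "std_symplectic_form x (c *\<^sub>R y) = c * std_symplectic_form x y"
    for x y :: "(real^'n) \<times> (real^'n)" and c
    by (simp add: std_symplectic_form_def algebra_simps)
  \<comment> \<open>Pairing \<open>eq2\<close> with \<open>S v\<close> equates a multiple
    \<open>t\<close> of a positive number with a nonpositive one, so \<open>t = 0\<close>.\<close>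
  have "t * std_symplectic_form (S v) (S (cstr v)) = std_symplectic_form (S v) ((- (1 - t)) *\<^sub>R cstr (S v))"
    unfolding eq2[symmetric] scale ..
  also have "\<dots> = - (1 - t) * (S v \<bullet> S v)"
    by (subst scale) (simp add: std_symplectic_form_cstr)
  finally have *: "t * std_symplectic_form (S v) (S (cstr v)) = - ((1 - t) * (S v \<bullet> S v))"
    by (simp add: algebra_simps)
  have "(1 - t) * (S v \<bullet> S v) \<ge> 0" using t by simp
  with * have "t * std_symplectic_form (S v) (S (cstr v)) \<le> 0" by linarith
  with pos t have "t = 0" by (simp add: mult_le_0_iff)
  with eq have "S v = 0" by simp
  with pos show False by (simp add: std_symplectic_form_def)
qed

section \<open>Complex linear maps in complex dimension 2\<close>

lemma quadratic_roots_three: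
  fixes p q :: complex
  assumes "x^2 + p * x + q = 0" "y^2 + p * y + q = 0" "z^2 + p * z + q = 0" "x \<noteq> y" "x \<noteq> z"
  shows "y = z"
proof -
  have factor: "(x - w) * (x + w + p) = (x^2 + p * x + q) - (w^2 + p * w + q)" for w
    by (simp add: algebra_simps power2_eq_square)
  have "(x - y) * (x + y + p) = 0" "(x - z) * (x + z + p) = 0"
    unfolding factor assms by simp_all
  with assms(4,5) have "x + y + p = x + z + p" by simp
  then show ?thesis by simp
qed

text \<open>Complex scalar multiplication, with \<open>cstr\<close> as the imaginary unit.\<close>

definition cscale :: "complex \<Rightarrow> (real^'n) \<times> (real^'n) \<Rightarrow> (real^'n) \<times> (real^'n)" where
  "cscale z v = Re z *\<^sub>R v + Im z *\<^sub>R cstr v"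

text \<open>A map commuting with \<open>cstr\<close> is a complex 2 by 2 matrix, and the quadratic
  is its characteristic polynomial: \<open>p\<close> is minus the trace and \<open>q\<close> the
  determinant.\<close>

lemma eigenvalue_quadratic:
  fixes C :: "(real^2) \<times> (real^2) \<Rightarrow> (real^2) \<times> (real^2)"
  assumes C: "linear C" and comm: "\<And>v. C (cstr v) = cstr (C v)"
  obtains p q where "\<And>z v. v \<noteq> 0 \<Longrightarrow> C v = cscale z v \<Longrightarrow> z^2 + p * z + q = 0"
proof
  \<comment> \<open>\<open>k i\<close> is the complex coordinate with index \<open>i\<close>, and
    \<open>e\<close> below is the standard complex basis.\<close>
  define k where "k = (\<lambda>i (v::(real^2)\<times>(real^2)). Complex (fst v $ i) (snd v $ i))"
  define e where "e = (\<lambda>i::2. (axis i 1, 0) :: (real^2)\<times>(real^2))"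
  have k_scale: "k i (cscale z v) = z * k i v" for i z v
    by (simp add: k_def cscale_def cstr_def complex_eq_iff algebra_simps)
  have k_add: "k i (v + w) = k i v + k i w" for i v w
    by (simp add: k_def complex_eq_iff)
  have dec: "v = cscale (k 1 v) (e 1) + cscale (k 2 v) (e 2)" for v
    by (cases v) (simp add: k_def e_def cscale_def cstr_def vec_eq_iff forall_2 axis_def)
  have Cs: "C (cscale z v) = cscale z (C v)" for z v
    by (simp add: cscale_def linear_add[OF C] linear_cmul[OF C] comm)
  fix z v assume v: "v \<noteq> 0" and eig: "C v = cscale z v"
  have "C v = cscale (k 1 v) (C (e 1)) + cscale (k 2 v) (C (e 2))"
    by (subst dec[of v]) (simp only: linear_add[OF C] Cs)
  then have kC: "z * k i v = k 1 v * k i (C (e 1)) + k 2 v * k i (C (e 2))" for i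
    using eig by (metis k_scale k_add)
  have nz: "k 1 v \<noteq> 0 \<or> k 2 v \<noteq> 0"
    using v dec[of v] by (auto simp: cscale_def)
  define a b c d where "a = k 1 (C (e 1))" and "b = k 1 (C (e 2))" and "c = k 2 (C (e 1))" and "d = k 2 (C (e 2))"
  have 1: "(z - a) * k 1 v = b * k 2 v" and 2: "(z - d) * k 2 v = c * k 1 v"
    using kC[of 1] kC[of 2] by (simp_all add: a_def b_def c_def d_def algebra_simps)
  \<comment> \<open>Elimination shows that the characteristic polynomial at \<open>z\<close>
    annihilates both coordinates of \<open>v\<close>, one of which is nonzero.\<close>
  have "((z - a) * (z - d) - b * c) * k 1 v = (z - d) * ((z - a) * k 1 v) - b * (c * k 1 v)"
    by (simp add: algebra_simps)
  also have "\<dots> = 0" unfolding 1 2[symmetric] by simp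
  finally have "((z - a) * (z - d) - b * c) * k 1 v = 0" .
  moreover have "((z - a) * (z - d) - b * c) * k 2 v = (z - a) * ((z - d) * k 2 v) - c * (b * k 2 v)"
    by (simp add: algebra_simps)
  then have "((z - a) * (z - d) - b * c) * k 2 v = 0" unfolding 2 1[symmetric] by simp
  ultimately have "(z - a) * (z - d) - b * c = 0" using nz by auto
  then show "z^2 + (- k 1 (C (e 1)) - k 2 (C (e 2))) * z + (k 1 (C (e 1)) * k 2 (C (e 2)) - k 1 (C (e 2)) * k 2 (C (e 1))) = 0"
    by (simp add: a_def b_def c_def d_def algebra_simps power2_eq_square)
qed

text \<open>The segment from \<open>C\<close> to a scalar \<open>m\<close> meets a singular map only
  if \<open>C\<close> has an eigenvalue on the ray opposite to \<open>m\<close>. There are at most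
  two eigenvalues, so one of the three scalars 1, i, -i is safe. From each of these the segment to 1
  misses 0, so the homotopy continues to the identity.\<close>

lemma complex_linear_homotopic_id:
  fixes C :: "(real^2) \<times> (real^2) \<Rightarrow> (real^2) \<times> (real^2)"
  assumes C: "linear C" and comm: "\<And>v. C (cstr v) = cstr (C v)"
    and inj: "\<And>v. v \<noteq> 0 \<Longrightarrow> C v \<noteq> 0"
  shows "homotopic_with_canon (\<lambda>_. True) (sphere 0 1) (- {0}) C (\<lambda>u. u)"
proof -
  obtain p q where pq: "\<And>z v. v \<noteq> 0 \<Longrightarrow> C v = cscale z v \<Longrightarrow> z^2 + p * z + q = 0"
    using eigenvalue_quadratic[OF C comm] by blast
  have cs_eq0: "cscale z v = 0 \<longleftrightarrow> z = 0 \<or> v = 0" for z and v :: "(real^2) \<times> (real^2)"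
  proof -
    have "cscale (cnj z) (cscale z v) = (Re z ^ 2 + Im z ^ 2) *\<^sub>R v"
      by (simp add: cscale_def linear_add[OF linear_cstr] linear_cmul[OF linear_cstr] algebra_simps power2_eq_square)
    moreover have "cscale (cnj z) (0 :: (real^2) \<times> (real^2)) = 0"
      by (simp add: cscale_def linear_0[OF linear_cstr])
    ultimately have "cscale z v = 0 \<Longrightarrow> Re z ^ 2 + Im z ^ 2 = 0 \<or> v = 0"
      by simp
    then show ?thesis by (auto simp: cscale_def complex_eq_iff linear_0[OF linear_cstr] sum_power2_eq_zero_iff)
  qed
  \<comment> \<open>Otherwise the three opposite rays, which are pairwise disjoint, would contain
    three distinct roots of one quadratic.\<close>
  have "\<exists>m\<in>{1, \<i>, - \<i>}. \<forall>s>0. \<forall>v. v \<noteq> 0 \<longrightarrow> C v \<noteq> cscale (- of_real s * m) v"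
  proof (rule ccontr)
    assume "\<not> ?thesis"
    then have ex: "\<exists>s v. s > 0 \<and> v \<noteq> 0 \<and> C v = cscale (- of_real s * m) v"
      if "m \<in> {1, \<i>, - \<i>}" for m
      using that by blast
    obtain s1 v1 s2 v2 s3 v3 where
      "s1 > 0" "v1 \<noteq> 0" "C v1 = cscale (- of_real s1 * 1) v1"
      "s2 > 0" "v2 \<noteq> 0" "C v2 = cscale (- of_real s2 * \<i>) v2"
      "s3 > 0" "v3 \<noteq> 0" "C v3 = cscale (- of_real s3 * (- \<i>)) v3"
      using ex[of 1] ex[of \<i>] ex[of "- \<i>"] by blast
    note * = this
    have "- of_real s2 * \<i> = - of_real s3 * (- \<i>)"
      by (rule quadratic_roots_three[OF pq[OF *(2,3)] pq[OF *(5,6)] pq[OF *(8,9)]])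
        (use * in \<open>auto simp: complex_eq_iff\<close>)
    with *(4,7) show False by (auto simp: complex_eq_iff)
  qed
  then obtain m where m: "m \<in> {1, \<i>, - \<i>}" and sm: "\<And>s v. s > 0 \<Longrightarrow> v \<noteq> 0 \<Longrightarrow> C v \<noteq> cscale (- of_real s * m) v"
    by blast
  have contC: "continuous_on A C" for A
    using C by (simp add: linear_continuous_on linear_conv_bounded_linear)
  have conts: "continuous_on A (cscale m)" for A
    unfolding cscale_def[abs_def] cstr_def by (intro continuous_intros)
  have scale: "cscale (of_real r * z) v = r *\<^sub>R cscale z v" for r z and v :: "(real^2) \<times> (real^2)"
    by (simp add: cscale_def algebra_simps)
  have "homotopic_with_canon (\<lambda>_. True) (sphere 0 1) (- {0}) C (cscale m)"
  proof (rule homotopic_with_linear[OF contC conts])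
    fix u :: "(real^2) \<times> (real^2)" assume "u \<in> sphere 0 1"
    then have u: "u \<noteq> 0" by auto
    show "closed_segment (C u) (cscale m u) \<subseteq> - {0}"
    proof clarsimp
      assume "0 \<in> closed_segment (C u) (cscale m u)"
      then obtain t where t: "0 \<le> t" "t \<le> 1" and eq: "0 = (1 - t) *\<^sub>R C u + t *\<^sub>R cscale m u"
        by (auto simp: in_segment)
      have "t \<noteq> 1" using eq u m by (auto simp: cs_eq0)
      have "t \<noteq> 0" using eq u inj[of u] by auto
      \<comment> \<open>Division by \<open>1 - t\<close> exhibits \<open>- (t / (1 - t)) * m\<close>
        as an eigenvalue on the excluded ray.\<close>
      have "(1 - t) *\<^sub>R C u = (- t) *\<^sub>R cscale m u"
        using eq by (simp add: eq_neg_iff_add_eq_0)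
      then have "inverse (1 - t) *\<^sub>R ((1 - t) *\<^sub>R C u) = inverse (1 - t) *\<^sub>R ((- t) *\<^sub>R cscale m u)" by simp
      then have "C u = (- (t / (1 - t))) *\<^sub>R cscale m u"
        using \<open>t \<noteq> 1\<close> by (simp add: divide_inverse mult.commute)
      then have "C u = cscale (- of_real (t / (1 - t)) * m) u"
        by (metis of_real_minus scale)
      with sm[of "t / (1 - t)" u] show False using t \<open>t \<noteq> 0\<close> \<open>t \<noteq> 1\<close> u by simp
    qed
  qed
  moreover have "homotopic_with_canon (\<lambda>_. True) (sphere 0 1) (- {0}) (cscale m) (\<lambda>u :: (real^2) \<times> (real^2). u)"
  proof (rule homotopic_with_linear[OF conts continuous_on_id])
    fix u :: "(real^2) \<times> (real^2)" assume "u \<in> sphere 0 1"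
    then have u: "u \<noteq> 0" by auto
    show "closed_segment (cscale m u) u \<subseteq> - {0}"
    proof clarsimp
      assume "0 \<in> closed_segment (cscale m u) u"
      then obtain t where t: "0 \<le> t" "t \<le> 1" and "0 = (1 - t) *\<^sub>R cscale m u + t *\<^sub>R u"
        by (auto simp: in_segment)
      then have "cscale (of_real (1 - t) * m + of_real t) u = 0"
        by (simp add: cscale_def algebra_simps)
      then have "of_real (1 - t) * m + of_real t = 0" using u by (simp add: cs_eq0)
      with m t show False by (auto simp: complex_eq_iff)
    qed
  qed
  ultimately show ?thesis by (rule homotopic_with_trans)
qed

text \<open>Two straight-line homotopies: from \<open>S\<close> to its complex linear part, then on
  through complex linear maps.\<close>

lemma symplectic_linear_homotopic_id:
  fixes S :: "(real^2) \<times> (real^2) \<Rightarrow> (real^2) \<times> (real^2)"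
  assumes S: "linear S"
    and symp: "\<And>v w. std_symplectic_form (S v) (S w) = std_symplectic_form v w"
  shows "homotopic_with_canon (\<lambda>_. True) (sphere 0 1) (- {0}) S (\<lambda>u. u)"
proof -
  define C where "C = (\<lambda>v. (1/2) *\<^sub>R (S v - cstr (S (cstr v))))"
  have C: "linear C"
    unfolding C_def
    by (rule linearI) (simp_all add: linear_add[OF S] linear_add[OF linear_cstr] linear_cmul[OF S]
        linear_cmul[OF linear_cstr] algebra_simps)
  have comm: "C (cstr v) = cstr (C v)" for v
    by (simp add: C_def linear_cmul[OF linear_cstr] linear_diff[OF linear_cstr] linear_neg[OF S] 
        linear_neg[OF linear_cstr] add.commute)
  have seg: "0 \<notin> closed_segment (S v) (C v)" if "v \<noteq> 0" for v
  proof
    assume "0 \<in> closed_segment (S v) (C v)"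
    then obtain t where t: "0 \<le> t" "t \<le> 1" and 0: "0 = (1 - t) *\<^sub>R S v + t *\<^sub>R C v"
      by (auto simp: in_segment)
    \<comment> \<open>\<open>C\<close> is the midpoint of \<open>S\<close> and its conjugate, so
      parameter \<open>t\<close> towards \<open>C\<close> is parameter \<open>t/2\<close> towards
      the conjugate.\<close>
    have "1 - t/2 = (1 - t) + t/2" by simp
    then have "0 = (1 - t/2) *\<^sub>R S v - (t/2) *\<^sub>R cstr (S (cstr v))"
      unfolding 0 by (simp only: C_def scaleR_add_left scaleR_diff_right scaleR_scaleR) simp
    with symplectic_segment_complex_linear[OF S symp that, of "t/2"] t show False by simp
  qed
  have cont: "continuous_on A C" "continuous_on A S" for A
    using C S by (simp_all add: linear_continuous_on linear_conv_bounded_linear)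
  have "homotopic_with_canon (\<lambda>_. True) (sphere 0 1) (- {0}) S C"
    by (rule homotopic_with_linear[OF cont(2,1)]) (use seg in force)
  moreover have "homotopic_with_canon (\<lambda>_. True) (sphere 0 1) (- {0}) C (\<lambda>u. u)"
    by (rule complex_linear_homotopic_id[OF C comm]) (use seg ends_in_segment(2) in fastforce)
  ultimately show ?thesis by (rule homotopic_with_trans)
qed

section \<open>Local orientation of continuous maps\<close>

abbreviation sphere_homotopic :: "('a::euclidean_space \<Rightarrow> 'a) \<Rightarrow> ('a \<Rightarrow> 'a) \<Rightarrow> bool"  (infix \<open>\<simeq>\<^sub>S\<close> 50) where
  "f \<simeq>\<^sub>S g \<equiv> homotopic_with_canon (\<lambda>_. True) (sphere 0 1) (- {0}) f g"

text \<open>Rescaling by \<open>r\<close> puts the spheres around all centres and of all radii on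
  the one domain \<open>sphere 0 1\<close>, so that their classes can be compared.\<close>

definition displacement :: "('a::real_normed_vector \<Rightarrow> 'b::real_normed_vector) \<Rightarrow> 'a \<Rightarrow> real \<Rightarrow> 'a \<Rightarrow> 'b" where
  "displacement f x r = (\<lambda>u. f (x + r *\<^sub>R u) - f x)"

declare homotopic_with_trans [trans]

text \<open>The segment from \<open>f u\<close> to \<open>g u\<close> is too short to reach the
  origin.\<close>

lemma sphere_homotopic_close:
  assumes "continuous_on (sphere 0 1) f" "continuous_on (sphere 0 1) g"
    and "\<And>u. norm u = 1 \<Longrightarrow> norm (f u - g u) < norm (f u)"
  shows "f \<simeq>\<^sub>S g"
proof (rule homotopic_with_linear[OF assms(1,2)])
  fix u :: 'a assume "u \<in> sphere 0 1"
  then have u: "norm (f u - g u) < norm (f u)" using assms(3) by simp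
  have "0 \<notin> closed_segment (f u) (g u)"
  proof
    assume "0 \<in> closed_segment (f u) (g u)"
    then have "dist 0 (f u) \<le> dist (f u) (g u)"
      by (auto dest: dist_in_closed_segment simp: dist_commute)
    with u show False by (simp add: dist_norm)
  qed
  then show "closed_segment (f u) (g u) \<subseteq> - {0}" by blast
qed

lemma scale_in_cball: "norm u \<le> 1 \<Longrightarrow> 0 \<le> r \<Longrightarrow> x + r *\<^sub>R u \<in> cball x r"
  by (simp add: dist_norm mult_left_le)

lemma continuous_on_displacement:
  assumes "continuous_on (cball x r) f" "r > 0"
  shows "continuous_on (sphere 0 1) (displacement f x r)"
  unfolding displacement_def
  by (intro continuous_intros continuous_on_compose2[OF assms(1)])
    (use assms(2) in \<open>auto intro!: scale_in_cball\<close>)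

lemma displacement_nonzero:
  assumes "inj_on f (cball x r)" "r > 0" "norm u = 1"
  shows "displacement f x r u \<noteq> 0"
proof
  assume "displacement f x r u = 0"
  then have "x + r *\<^sub>R u = x"
    by (intro inj_onD[OF assms(1), of "x + r *\<^sub>R u" x])
      (use assms scale_in_cball[of u r x] in \<open>auto simp: displacement_def\<close>)
  with assms show False by auto
qed

text \<open>Centre and radius are interpolated linearly. By convexity the intermediate balls stay in
  \<open>C\<close>, and injectivity there keeps the displacement away from 0.\<close>

lemma displacement_homotopic:
  fixes f :: "'a::euclidean_space \<Rightarrow> 'a"
  assumes C: "convex C" and cont: "continuous_on C f" and inj: "inj_on f C"
    and x: "cball x r \<subseteq> C" "r > 0" and y: "cball y s \<subseteq> C" "s > 0"
  shows "displacement f x r \<simeq>\<^sub>S displacement f y s"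
proof -
  define c where "c = (\<lambda>t::real. (1 - t) *\<^sub>R x + t *\<^sub>R y)"
  define \<rho> where "\<rho> = (\<lambda>t::real. (1 - t) * r + t * s)"
  have \<rho>: "\<rho> t > 0" if "t \<in> {0..1}" for t
  proof (cases "t = 0")
    case False
    then show ?thesis using that x(2) y(2) unfolding \<rho>_def
      by (intro add_nonneg_pos mult_pos_pos mult_nonneg_nonneg) auto
  qed (simp add: \<rho>_def x)
  have inC: "c t + \<rho> t *\<^sub>R u \<in> C" if "t \<in> {0..1}" "norm u \<le> 1" for t u
  proof -
    have "x + r *\<^sub>R u \<in> C" "y + s *\<^sub>R u \<in> C"
      using x y that(2) scale_in_cball[of u r x] scale_in_cball[of u s y] by auto
    then have "(1 - t) *\<^sub>R (x + r *\<^sub>R u) + t *\<^sub>R (y + s *\<^sub>R u) \<in> C"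
      using C that(1) by (auto simp: convex_alt)
    then show ?thesis by (simp add: c_def \<rho>_def algebra_simps)
  qed
  have cC: "c t \<in> C" if "t \<in> {0..1}" for t using inC[OF that, of 0] by simp
  define h where "h = (\<lambda>(t, u). f (c t + \<rho> t *\<^sub>R u) - f (c t))"
  have "continuous_on ({0..1} \<times> sphere 0 1) h"
    unfolding h_def split_beta
    by (intro continuous_intros continuous_on_compose2[OF cont])
      (auto simp: c_def[abs_def] \<rho>_def[abs_def] intro!: continuous_intros inC[unfolded c_def \<rho>_def]
        cC[unfolded c_def])
  moreover have "h (t, u) \<noteq> 0" if "t \<in> {0..1}" "u \<in> sphere 0 1" for t u
  proof
    assume "h (t, u) = 0"
    then have "f (c t + \<rho> t *\<^sub>R u) = f (c t)" by (simp add: h_def)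
    then have "c t + \<rho> t *\<^sub>R u = c t"
      by (rule inj_onD[OF inj]) (use that in \<open>simp_all add: inC cC del: atLeastAtMost_iff\<close>)
    with \<rho>[OF that(1)] that(2) show False by auto
  qed
  ultimately show ?thesis
    unfolding homotopic_with_def
    by (intro exI[of _ h])
      (auto simp: h_def displacement_def c_def \<rho>_def continuous_map_in_subtopology)
qed

section \<open>The class of a composition\<close>

text \<open>Each vector moves along its own ray. The homotopy is kept inside
  \<open>cball 0 R\<close> so that it can be followed by a map defined on that ball only.\<close>

lemma normalize_homotopic:
  fixes w :: "'a::euclidean_space \<Rightarrow> 'a"
  assumes cont: "continuous_on (sphere 0 1) w" and nz: "\<And>u. norm u = 1 \<Longrightarrow> w u \<noteq> 0"
    and R: "\<And>u. norm u = 1 \<Longrightarrow> norm (w u) \<le> R" and s: "0 < s" "s \<le> R"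
  shows "homotopic_with_canon (\<lambda>_. True) (sphere 0 1) (cball 0 R - {0}) w (\<lambda>u. s *\<^sub>R (w u /\<^sub>R norm (w u)))"
proof (rule homotopic_with_linear[OF cont])
  show "continuous_on (sphere 0 1) (\<lambda>u. s *\<^sub>R (w u /\<^sub>R norm (w u)))"
    by (intro continuous_intros cont) (use nz in auto)
  fix u :: 'a assume "u \<in> sphere 0 1"
  then have u: "w u \<noteq> 0" "norm (w u) \<le> R" using nz R by auto
  let ?z = "s *\<^sub>R (w u /\<^sub>R norm (w u))"
  have "closed_segment (w u) ?z \<subseteq> cball 0 R"
    using u s by (intro closed_segment_subset) (auto simp: mult.assoc)
  moreover have "0 \<notin> closed_segment (w u) ?z"
  proof
    assume "0 \<in> closed_segment (w u) ?z"
    then obtain t where t: "0 \<le> t" "t \<le> 1" and "0 = (1 - t) *\<^sub>R w u + t *\<^sub>R ?z"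
      by (auto simp: in_segment)
    then have "((1 - t) + t * s / norm (w u)) *\<^sub>R w u = 0"
      by (simp add: scaleR_add_left divide_inverse mult.assoc)
    then have 0: "(1 - t) + t * s / norm (w u) = 0" using u by simp
    have "t * s / norm (w u) \<ge> 0" using t s by simp
    with 0 t have "t = 1" by linarith
    with 0 s u show False by simp
  qed
  ultimately show "closed_segment (w u) ?z \<subseteq> cball 0 R - {0}" by blast
qed

text \<open>A chain rule for classes: the displacement of \<open>f\<close> is pushed radially to the
  sphere of radius \<open>s\<close>, \<open>g\<close> is applied, and then \<open>h\<close> replaces
  the displacement of \<open>f\<close>.\<close>

lemma displacement_compose:
  fixes f g :: "'a::euclidean_space \<Rightarrow> 'a"
  assumes f: "continuous_on (cball x r) f" "inj_on f (cball x r)" "r > 0"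
    and g: "continuous_on (cball (f x) R) g" "inj_on g (cball (f x) R)"
    and fg: "f ` cball x r \<subseteq> cball (f x) R" and s: "0 < s" "s \<le> R"
    and h: "displacement f x r \<simeq>\<^sub>S h"
  shows "displacement (g \<circ> f) x r \<simeq>\<^sub>S (\<lambda>u. displacement g (f x) s (h u /\<^sub>R norm (h u)))"
proof -
  \<comment> \<open>On vectors of length \<open>s\<close> this is the displacement of
    \<open>g\<close> at \<open>f x\<close>; on the whole punctured ball it can act on the
    normalizing homotopy.\<close>
  define k where "k = (\<lambda>v. g (f x + v) - g (f x))"
  have k: "continuous_map (top_of_set (cball 0 R - {0})) (top_of_set (- {0})) k"
  proof -
    have "continuous_on (cball 0 R - {0}) k"
      unfolding k_def by (intro continuous_intros continuous_on_compose2[OF g(1)]) (auto simp: dist_norm)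
    moreover have "k v \<noteq> 0" if "v \<in> cball 0 R - {0}" for v
    proof
      assume "k v = 0"
      then have "f x + v = f x"
        by (intro inj_onD[OF g(2), of "f x + v" "f x"]) (use that s in \<open>auto simp: k_def dist_norm\<close>)
      with that show False by simp
    qed
    ultimately show ?thesis by (auto simp: continuous_map_in_subtopology)
  qed
  have "norm (displacement f x r u) \<le> R" if "norm u = 1" for u
  proof -
    have "f (x + r *\<^sub>R u) \<in> cball (f x) R"
      using fg f(3) that scale_in_cball[of u r x] by (simp only: image_subset_iff)
    then show ?thesis by (simp add: displacement_def dist_norm norm_minus_commute)
  qed
  then have "homotopic_with_canon (\<lambda>_. True) (sphere 0 1) (cball 0 R - {0}) (displacement f x r)
      (\<lambda>u. s *\<^sub>R (displacement f x r u /\<^sub>R norm (displacement f x r u)))"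
    using f s by (intro normalize_homotopic continuous_on_displacement displacement_nonzero)
  from homotopic_with_compose_continuous_map_left[OF this k, where q = "\<lambda>_. True"]
  have "(k \<circ> displacement f x r)
      \<simeq>\<^sub>S (k \<circ> (\<lambda>u. s *\<^sub>R (displacement f x r u /\<^sub>R norm (displacement f x r u))))" by simp
  moreover have "k \<circ> displacement f x r = displacement (g \<circ> f) x r"
    by (auto simp: k_def displacement_def)
  \<comment> \<open>The homotopy to \<open>h\<close> may leave the ball where \<open>g\<close> is
    controlled, so the displacement of \<open>g\<close> is extended to be constant along
    rays.\<close>
  moreover have "continuous_map (top_of_set (- {0})) (top_of_set (- {0})) (\<lambda>v. displacement g (f x) s (v /\<^sub>R norm v))"
  proof -
    have "cball (f x) s \<subseteq> cball (f x) R" using s by auto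
    then have gs: "continuous_on (cball (f x) s) g" "inj_on g (cball (f x) s)"
      using g continuous_on_subset inj_on_subset by blast+
    have "continuous_on (- {0}) (\<lambda>v. displacement g (f x) s (v /\<^sub>R norm v))"
    proof (rule continuous_on_compose2[OF continuous_on_displacement[OF gs(1) s(1)]])
      show "continuous_on (- {0}) (\<lambda>v::'a. v /\<^sub>R norm v)" by (intro continuous_intros) auto
      show "(\<lambda>v::'a. v /\<^sub>R norm v) ` (- {0}) \<subseteq> sphere 0 1"
      proof (rule image_subsetI)
        fix v :: 'a assume "v \<in> - {0}"
        then show "v /\<^sub>R norm v \<in> sphere 0 1" by simp
      qed
    qed
    moreover have "displacement g (f x) s (v /\<^sub>R norm v) \<noteq> 0" if "v \<noteq> 0" for v
      using that by (intro displacement_nonzero gs s) auto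
    ultimately show ?thesis by (auto simp: continuous_map_in_subtopology)
  qed
  from homotopic_with_compose_continuous_map_left[OF h this, where q = "\<lambda>_. True"]
  have "(\<lambda>u. displacement g (f x) s (displacement f x r u /\<^sub>R norm (displacement f x r u)))
      \<simeq>\<^sub>S (\<lambda>u. displacement g (f x) s (h u /\<^sub>R norm (h u)))"
    by (simp add: o_def)
  ultimately show ?thesis
    by (simp add: o_def k_def displacement_def) (rule homotopic_with_trans)
qed

text \<open>If \<open>g\<close> has the class of the identity, the chain rule leaves the normalized
  displacement of \<open>f\<close>, which is homotopic to the displacement itself.\<close>

lemma displacement_compose_id:
  fixes f g :: "'a::euclidean_space \<Rightarrow> 'a"
  assumes f: "continuous_on (cball x r) f" "inj_on f (cball x r)" "r > 0"
    and g: "continuous_on (cball (f x) R) g" "inj_on g (cball (f x) R)"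
    and fg: "f ` cball x r \<subseteq> cball (f x) R" and s: "0 < s" "s \<le> R"
    and id: "displacement g (f x) s \<simeq>\<^sub>S (\<lambda>u. u)"
  shows "displacement (g \<circ> f) x r \<simeq>\<^sub>S displacement f x r"
proof -
  let ?w = "displacement f x r"
  have cw: "continuous_on (sphere 0 1) ?w" by (rule continuous_on_displacement[OF f(1,3)])
  have nz: "?w u \<noteq> 0" if "norm u = 1" for u by (rule displacement_nonzero[OF f(2,3) that])
  have 1: "displacement (g \<circ> f) x r \<simeq>\<^sub>S (\<lambda>u. displacement g (f x) s (?w u /\<^sub>R norm (?w u)))"
    by (rule displacement_compose[OF assms(1-8)]) (use cw nz in \<open>auto simp: homotopic_with_refl\<close>)
  have "continuous_map (top_of_set (sphere 0 1)) (top_of_set (sphere 0 1)) (\<lambda>u. ?w u /\<^sub>R norm (?w u))"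
    using cw nz by (auto simp: continuous_map_in_subtopology intro!: continuous_intros)
  from homotopic_with_compose_continuous_map_right[OF id this, where q = "\<lambda>_. True"]
  have 2: "(\<lambda>u. displacement g (f x) s (?w u /\<^sub>R norm (?w u))) \<simeq>\<^sub>S (\<lambda>u. ?w u /\<^sub>R norm (?w u))"
    by (simp add: o_def)
  obtain M where M: "norm (?w u) \<le> M" if "norm u = 1" for u
    using compact_imp_bounded[OF compact_continuous_image[OF cw compact_sphere]]
    unfolding bounded_iff by (metis imageI mem_sphere_0)
  \<comment> \<open>The bound \<open>max M 1\<close> makes room for both the given displacement and
    the unit vectors.\<close>
  have "homotopic_with_canon (\<lambda>_. True) (sphere 0 1) (cball 0 (max M 1) - {0}) ?w (\<lambda>u. 1 *\<^sub>R (?w u /\<^sub>R norm (?w u)))"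
    by (rule normalize_homotopic[OF cw nz]) (use M in \<open>auto simp: le_max_iff_disj\<close>)
  then have "?w \<simeq>\<^sub>S (\<lambda>u. ?w u /\<^sub>R norm (?w u))"
    by (auto intro: homotopic_with_subset_right)
  with 1 2 show ?thesis by (meson homotopic_with_trans homotopic_with_sym)
qed

section \<open>Uniform limits and derivatives\<close>

text \<open>By compactness the displacement of \<open>f\<close> has norm at least some
  \<open>m > 0\<close>. Errors below \<open>m / 2\<close> at the centre and on the sphere change it
  by less than \<open>m\<close>.\<close>

lemma displacement_uniform_limit:
  fixes f :: "'a::euclidean_space \<Rightarrow> 'a"
  assumes f: "continuous_on (cball x r) f" "inj_on f (cball x r)" "r > 0"
    and lim: "uniform_limit (cball x r) \<phi> f sequentially"
    and \<phi>: "\<And>k. continuous_on (cball x r) (\<phi> k)"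
  shows "eventually (\<lambda>k. displacement f x r \<simeq>\<^sub>S displacement (\<phi> k) x r) sequentially"
proof -
  let ?w = "displacement f x r"
  have cw: "continuous_on (sphere 0 1) ?w" by (rule continuous_on_displacement[OF f(1,3)])
  have "compact (?w ` sphere 0 1)" "0 \<notin> ?w ` sphere 0 1"
    using compact_continuous_image[OF cw] displacement_nonzero[OF f(2,3)] by auto
  then obtain m where m: "m > 0" "\<And>u. norm u = 1 \<Longrightarrow> m \<le> norm (?w u)"
    using separate_point_closed[of "?w ` sphere 0 1" 0] by (auto simp: compact_imp_closed)
  have "eventually (\<lambda>k. \<forall>y\<in>cball x r. dist (\<phi> k y) (f y) < m / 2) sequentially"
    using uniform_limitD[OF lim, of "m / 2"] m(1) by simp
  then show ?thesis
  proof eventually_elim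
    case (elim k)
    show ?case
    proof (rule sphere_homotopic_close[OF cw continuous_on_displacement[OF \<phi> f(3)]])
      fix u :: 'a assume u: "norm u = 1"
      have "dist (\<phi> k (x + r *\<^sub>R u)) (f (x + r *\<^sub>R u)) < m / 2" "dist (\<phi> k x) (f x) < m / 2"
        using elim u f(3) scale_in_cball[of u r x] by auto
      moreover have "norm (?w u - displacement (\<phi> k) x r u)
          \<le> dist (\<phi> k (x + r *\<^sub>R u)) (f (x + r *\<^sub>R u)) + dist (\<phi> k x) (f x)"
        unfolding displacement_def dist_norm
        using norm_triangle_ineq4[of "\<phi> k x - f x" "\<phi> k (x + r *\<^sub>R u) - f (x + r *\<^sub>R u)"]
        by (simp add: algebra_simps)
      ultimately show "norm (?w u - displacement (\<phi> k) x r u) < norm (?w u)"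
        using m(2)[OF u] by linarith
    qed
  qed
qed

text \<open>On a small enough sphere the linearization error is at most half of the least length of
  the linear part; the class does not depend on the radius.\<close>

lemma displacement_derivative:
  fixes f :: "'a::euclidean_space \<Rightarrow> 'a"
  assumes f: "continuous_on (cball x r) f" "inj_on f (cball x r)" "r > 0"
    and deriv: "(f has_derivative L) (at x)" and L: "\<And>v. v \<noteq> 0 \<Longrightarrow> L v \<noteq> 0"
  shows "displacement f x r \<simeq>\<^sub>S L"
proof -
  have bl: "bounded_linear L" using deriv by (rule has_derivative_bounded_linear)
  then have lin: "linear L" by (rule bounded_linear.linear)
  have cL: "continuous_on A L" for A using bl by (rule linear_continuous_on)
  have "compact (L ` sphere 0 1)" "0 \<notin> L ` sphere 0 1"
    using compact_continuous_image[OF cL] L by (auto simp: image_iff) (metis norm_zero zero_neq_one)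
  then obtain m where m: "m > 0" "\<And>u. norm u = 1 \<Longrightarrow> m \<le> norm (L u)"
    using separate_point_closed[of "L ` sphere 0 1" 0] by (auto simp: compact_imp_closed)
  obtain d where d: "d > 0" "\<And>y. norm (y - x) < d \<Longrightarrow> norm (f y - f x - L (y - x)) \<le> m / 2 * norm (y - x)"
    using deriv m(1) unfolding has_derivative_at_alt by (meson half_gt_zero)
  define s where "s = min r (d / 2)"
  have s: "s > 0" "s \<le> r" "s < d" using d(1) f(3) by (auto simp: s_def)
  have "displacement f x r \<simeq>\<^sub>S displacement f x s"
    by (rule displacement_homotopic[OF convex_cball f(1,2)]) (use s f in auto)
  also have "displacement f x s \<simeq>\<^sub>S (\<lambda>u. s *\<^sub>R L u)"
  \<comment> \<open>The linear map goes first, because the closeness criterion is relative to the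
    first map and the lower bound is known for \<open>L\<close>.\<close>
  proof (subst homotopic_with_sym, rule sphere_homotopic_close)
    show "continuous_on (sphere 0 1) (displacement f x s)"
      using s f by (intro continuous_on_displacement continuous_on_subset[OF f(1)]) auto
    fix u :: 'a assume u: "norm u = 1"
    have "norm (f (x + s *\<^sub>R u) - f x - L (s *\<^sub>R u)) \<le> m / 2 * s"
      using d(2)[of "x + s *\<^sub>R u"] u s by simp
    moreover have "m * s \<le> norm (L u) * s" using m(2)[OF u] s by simp
    moreover have "m / 2 * s < m * s" using m(1) s(1) by simp
    moreover have "norm (s *\<^sub>R L u - displacement f x s u) = norm (f (x + s *\<^sub>R u) - f x - L (s *\<^sub>R u))"
      by (simp add: displacement_def linear_cmul[OF lin] norm_minus_commute)
    moreover have "norm (s *\<^sub>R L u) = norm (L u) * s" using s(1) by simp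
    ultimately show "norm (s *\<^sub>R L u - displacement f x s u) < norm (s *\<^sub>R L u)"
      by linarith
  qed (intro continuous_intros cL)
  also have "(\<lambda>u. s *\<^sub>R L u) \<simeq>\<^sub>S L"
  proof (rule homotopic_with_linear)
    fix u :: 'a assume "u \<in> sphere 0 1"
    then have "u \<noteq> 0" by auto
    then have "L u \<noteq> 0" by (rule L)
    moreover have "(1 - t) * s + t \<noteq> 0" if "0 \<le> t" "t \<le> 1" for t
    proof -
      have "(1 - t) * s \<ge> 0" using that s(1) by simp
      then show ?thesis using that s(1) by (cases "t = 0") (simp, linarith)
    qed
    ultimately show "closed_segment (s *\<^sub>R L u) (L u) \<subseteq> - {0}"
      by (auto simp: in_segment simp flip: scaleR_add_left)
  qed (intro continuous_intros cL)+
  finally show ?thesis .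
qed

section \<open>Symplectic maps have the class of the identity\<close>

text \<open>The derivative is a linear symplectic map, injective because the form is nondegenerate,
  and it determines the class.\<close>

lemma symplectic_diffeomorphism_displacement:
  fixes f :: "(real^2) \<times> (real^2) \<Rightarrow> (real^2) \<times> (real^2)"
  assumes f: "symplectic_diffeomorphism U V f" and r: "cball x r \<subseteq> U" "r > 0"
  shows "displacement f x r \<simeq>\<^sub>S (\<lambda>u. u)"
proof -
  let ?L = "frechet_derivative f (at x)"
  have x: "x \<in> U" using r by auto
  from f have "smooth_on U f" and hom: "\<exists>g. homeomorphism U V f g"
    and symp: "\<And>v w. std_symplectic_form (?L v) (?L w) = std_symplectic_form v w"
    using x by (auto simp: symplectic_diffeomorphism_def diffeomorphism_between_def)
  then have "Ck_on (Suc 0) U f" unfolding smooth_on_def by blast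
  then have deriv: "(f has_derivative ?L) (at x)"
    using x frechet_derivative_works by auto
  then have lin: "linear ?L" by (rule has_derivative_linear)
  have nz: "?L v \<noteq> 0" if "v \<noteq> 0" for v
  proof
    assume "?L v = 0"
    then have "std_symplectic_form v (cstr v) = 0"
      using symp[of v "cstr v"] by (simp add: std_symplectic_form_def)
    with that show False by (simp add: std_symplectic_form_cstr)
  qed
  have "continuous_on (cball x r) f" "inj_on f (cball x r)"
    using hom r(1) by (auto simp: homeomorphism_def intro: continuous_on_subset inj_on_inverseI)
  then have "displacement f x r \<simeq>\<^sub>S ?L"
    by (rule displacement_derivative[OF _ _ r(2) deriv nz])
  also have "?L \<simeq>\<^sub>S (\<lambda>u. u)"
    by (rule symplectic_linear_homotopic_id[OF lin symp])
  finally show ?thesis .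
qed

text \<open>On a small ball one sufficiently late approximating symplectic diffeomorphism has the
  same class as \<open>f\<close>.\<close>

lemma symplectic_homeomorphism_displacement:
  fixes f :: "(real^2) \<times> (real^2) \<Rightarrow> (real^2) \<times> (real^2)"
  assumes f: "symplectic_homeomorphism U V f" and r: "cball x r \<subseteq> U" "r > 0"
  shows "displacement f x r \<simeq>\<^sub>S (\<lambda>u. u)"
proof -
  have "x \<in> U" using r by auto
  with f obtain W \<phi> where W: "open W" "x \<in> W" and \<phi>: "\<And>k. \<exists>V'. symplectic_diffeomorphism W V' (\<phi> k)"
    and lim: "uniform_limit W \<phi> f sequentially"
    unfolding symplectic_homeomorphism_def by meson
  from W obtain e where e: "e > 0" "cball x e \<subseteq> W" by (meson open_contains_cball)
  define s where "s = min r e"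
  have s: "s > 0" "cball x s \<subseteq> W" "cball x s \<subseteq> cball x r" using e r by (auto simp: s_def)
  obtain g where "homeomorphism U V f g" using f by (auto simp: symplectic_homeomorphism_def)
  then have cf: "continuous_on (cball x r) f" "inj_on f (cball x r)"
    using r(1) by (auto simp: homeomorphism_def intro: continuous_on_subset inj_on_inverseI)
  have "continuous_on (cball x s) (\<phi> k)" for k
    using \<phi>[of k] s(2) by (auto simp: symplectic_diffeomorphism_def diffeomorphism_between_def
        homeomorphism_def intro: continuous_on_subset)
  then have "eventually (\<lambda>k. displacement f x s \<simeq>\<^sub>S displacement (\<phi> k) x s) sequentially"
    by (intro displacement_uniform_limit continuous_on_subset[OF cf(1) s(3)] inj_on_subset[OF cf(2) s(3)]
        s(1) uniform_limit_on_subset[OF lim s(2)])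
  then obtain k where k: "displacement f x s \<simeq>\<^sub>S displacement (\<phi> k) x s"
    by (auto simp: eventually_sequentially)
  have "displacement f x r \<simeq>\<^sub>S displacement f x s"
    by (rule displacement_homotopic[OF convex_cball cf]) (use r s in auto)
  also note k
  also have "displacement (\<phi> k) x s \<simeq>\<^sub>S (\<lambda>u. u)"
    using \<phi>[of k] symplectic_diffeomorphism_displacement[OF _ s(2,1)] by blast
  finally show ?thesis .
qed

section \<open>The orientation obstruction\<close>

text \<open>Invariance of domain gives a local inverse \<open>k\<close>. Applying it to the supposed
  homotopy turns the displacement of \<open>f\<close> into that of the identity, which would then be
  homotopic to a reflection.\<close>

lemma displacement_not_homotopic_reflected:
  fixes f :: "'a::euclidean_space \<Rightarrow> 'a"
  assumes f: "continuous_on (cball x r) f" "inj_on f (cball x r)" "r > 0"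
    and e: "e \<in> Basis"
  shows "\<not> displacement f x r \<simeq>\<^sub>S displacement f x r \<circ> reflect e"
proof
  note norm_reflect[OF norm_Basis[OF e], simp]
  have "continuous_on (sphere 0 1) (reflect e)"
    unfolding reflect_def by (intro continuous_intros)
  then have refl: "continuous_map (top_of_set (sphere 0 1)) (top_of_set (sphere 0 1)) (reflect e)"
    by (auto simp: continuous_map_in_subtopology)
  have compose_reflect: "g \<circ> reflect e \<simeq>\<^sub>S h \<circ> reflect e" if "g \<simeq>\<^sub>S h" for g h :: "'a \<Rightarrow> 'a"
    using homotopic_with_compose_continuous_map_right[OF that refl, where q = "\<lambda>_. True"] by simp
  assume hom: "displacement f x r \<simeq>\<^sub>S displacement f x r \<circ> reflect e"
  have ball: "continuous_on (ball x r) f" "inj_on f (ball x r)"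
    using f continuous_on_subset inj_on_subset by (metis ball_subset_cball)+
  obtain k where k: "homeomorphism (ball x r) (f ` ball x r) f k"
    using invariance_of_domain_homeomorphism[OF open_ball ball(1) _ ball(2)] by auto
  have "open (f ` ball x r)" using invariance_of_domain[OF ball(1) open_ball ball(2)] .
  then obtain R where R: "R > 0" "cball (f x) R \<subseteq> f ` ball x r"
    using f(3) by (meson centre_in_ball image_eqI open_contains_cball)
  have "continuous (at x) f"
    using ball(1) f(3) by (simp add: continuous_on_eq_continuous_at)
  then obtain d where d: "d > 0" "\<And>y. dist y x < d \<Longrightarrow> dist (f y) (f x) < R"
    using R(1) unfolding continuous_at_eps_delta by blast
  \<comment> \<open>The smaller ball must lie in the open ball where \<open>k\<close> inverts
    \<open>f\<close>, and its image in the ball of radius \<open>R\<close>.\<close>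
  define s where "s = min r d / 2"
  have s: "s > 0" "s < r" "s < d" using f(3) d(1) by (auto simp: s_def)
  have fs: "continuous_on (cball x s) f" "inj_on f (cball x s)"
    using f(1,2) s continuous_on_subset inj_on_subset by (metis subset_cball less_imp_le)+
  have im: "f ` cball x s \<subseteq> cball (f x) R"
  proof (rule image_subsetI)
    fix y assume "y \<in> cball x s"
    then show "f y \<in> cball (f x) R" using d(2)[of y] s(3) by (simp add: dist_commute)
  qed
  have kR: "continuous_on (cball (f x) R) k" "inj_on k (cball (f x) R)"
  proof -
    have "continuous_on (f ` ball x r) k" "inj_on k (f ` ball x r)"
      using k by (auto simp: homeomorphism_def intro: inj_on_inverseI)
    then show "continuous_on (cball (f x) R) k" "inj_on k (cball (f x) R)"
      using R(2) continuous_on_subset inj_on_subset by blast+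
  qed
  have rs: "displacement f x s \<simeq>\<^sub>S displacement f x r"
    by (rule displacement_homotopic[OF convex_cball f(1,2)]) (use s f in auto)
  note rs
  also note hom
  also have "displacement f x r \<circ> reflect e \<simeq>\<^sub>S displacement f x s \<circ> reflect e"
    by (rule compose_reflect, subst homotopic_with_sym, rule rs)
  finally have hom_s: "displacement f x s \<simeq>\<^sub>S displacement f x s \<circ> reflect e" .
  note comp = displacement_compose[OF fs s(1) kR im R(1) order_refl]
  have "displacement f x s \<simeq>\<^sub>S displacement f x s"
    using continuous_on_displacement[OF fs(1) s(1)] displacement_nonzero[OF fs(2) s(1)] by auto
  \<comment> \<open>The chain rule is used with the displacement of \<open>f\<close> and with its
    reflection as \<open>h\<close>; the first result, reflected, ends in the same map as the
    second.\<close>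
  from compose_reflect[OF comp[OF this]] comp[OF hom_s]
  have kf_hom: "displacement (k \<circ> f) x s \<simeq>\<^sub>S displacement (k \<circ> f) x s \<circ> reflect e"
    by (simp add: o_def) (meson homotopic_with_sym homotopic_with_trans)
  have kf: "displacement (k \<circ> f) x s u = s *\<^sub>R u" if "norm u = 1" for u
  proof -
    have "x + s *\<^sub>R u \<in> ball x r" "x \<in> ball x r" using that s f(3) by (simp_all add: dist_norm)
    then show ?thesis using k by (simp add: displacement_def homeomorphism_def)
  qed
  have "(\<lambda>u::'a. s *\<^sub>R u) \<simeq>\<^sub>S (\<lambda>u. s *\<^sub>R reflect e u)"
    by (rule homotopic_with_eq[OF kf_hom]) (simp_all add: kf)
  moreover have "continuous_map (top_of_set (- {0})) (top_of_set (- {0})) (\<lambda>v::'a. v /\<^sub>R s)"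
    using s by (auto simp: continuous_map_in_subtopology intro!: continuous_intros)
  ultimately have "((\<lambda>v. v /\<^sub>R s) \<circ> (\<lambda>u::'a. s *\<^sub>R u)) \<simeq>\<^sub>S ((\<lambda>v. v /\<^sub>R s) \<circ> (\<lambda>u. s *\<^sub>R reflect e u))"
    by (rule homotopic_with_compose_continuous_map_left) simp
  then have "(\<lambda>u. u) \<simeq>\<^sub>S reflect e" using s by (simp add: o_def)
  with reflect_not_homotopic_id[OF e] show False by simp
qed

text \<open>Charts composed with \<open>p\<close> are injective on small balls. Their class is
  independent of the chart and locally constant, hence the same at \<open>0\<close> and at
  \<open>b\<close>, while \<open>deck\<close> makes the two differ by a reflection.\<close>

lemma no_symplectic_structure_orientation_reversing_deck:
  fixes p :: "(real^2) \<times> (real^2) \<Rightarrow> 'b::topological_space"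
    and \<A> :: "('b set \<times> ('b \<Rightarrow> (real^2) \<times> (real^2))) set"
  assumes p: "continuous_on UNIV p" and \<delta>: "\<delta> > 0" and inj: "\<And>v. inj_on p (cball v \<delta>)"
    and e: "e \<in> Basis" and deck: "\<And>v. p (reflect e v + b) = p v"
  shows "\<not> topological_symplectic_structure (top_of_set (range p)) \<A>"
proof
  assume A: "topological_symplectic_structure (top_of_set (range p)) \<A>"
  \<comment> \<open>The chart \<open>c\<close> lifts through \<open>p\<close> to an injective map on
    the ball of radius \<open>r\<close> around \<open>v\<close>.\<close>
  define good where "good = (\<lambda>c v r. c \<in> \<A> \<and> 0 < r \<and> r \<le> \<delta> \<and> p ` cball v r \<subseteq> fst c)"
  have chart: "openin (top_of_set (range p)) (fst c)" "continuous_on (fst c) (snd c)" "inj_on (snd c) (fst c)"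
    if "c \<in> \<A>" for c
  proof -
    obtain U \<phi> where c: "c = (U, \<phi>)" by force
    have "is_chart (top_of_set (range p)) (U, \<phi>)"
      using A that c by (auto simp: topological_symplectic_structure_def)
    then have U: "openin (top_of_set (range p)) U"
      and hm: "homeomorphic_map (subtopology (top_of_set (range p)) U) (top_of_set (\<phi> ` U)) \<phi>"
      by (auto simp: is_chart_def)
    have "U \<subseteq> range p" using openin_imp_subset[OF U] .
    then have "subtopology (top_of_set (range p)) U = top_of_set U"
      by (simp add: subtopology_subtopology Int_absorb1)
    with hm have "homeomorphic_map (top_of_set U) (top_of_set (\<phi> ` U)) \<phi>" by simp
    then have "continuous_on U \<phi>" "inj_on \<phi> U"
      by (auto dest: homeomorphic_imp_continuous_map homeomorphic_imp_injective_map
          simp: continuous_map_in_subtopology)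
    with U c show "openin (top_of_set (range p)) (fst c)" "continuous_on (fst c) (snd c)" "inj_on (snd c) (fst c)"
      by auto
  qed
  have ex_good: "\<exists>c r. good c v r" for v
  proof -
    have "p v \<in> (\<Union>c\<in>\<A>. fst c)"
      using A unfolding topological_symplectic_structure_def topspace_euclidean_subtopology by blast
    then obtain c where c: "c \<in> \<A>" "p v \<in> fst c" by blast
    have "open (p -` fst c)"
      using continuous_openin_preimage[of UNIV p "range p" "fst c"] p chart(1)[OF c(1)] by auto
    then obtain r where "r > 0" "cball v r \<subseteq> p -` fst c" using c(2) open_contains_cball by blast
    then have "good c v (min r \<delta>)" using c \<delta> by (auto simp: good_def)
    then show ?thesis by blast
  qed
  have cont: "continuous_on (cball v r) (snd c \<circ> p)" and injc: "inj_on (snd c \<circ> p) (cball v r)"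
    if "good c v r" for c v r
  proof -
    have sub: "cball v r \<subseteq> cball v \<delta>" and c: "c \<in> \<A>" "p ` cball v r \<subseteq> fst c" using that by (auto simp: good_def)
    show "continuous_on (cball v r) (snd c \<circ> p)"
      using continuous_on_subset[OF chart(2)[OF c(1)] c(2)] p
      by (intro continuous_on_compose) (auto intro: continuous_on_subset)
    show "inj_on (snd c \<circ> p) (cball v r)"
      using inj_on_subset[OF chart(3)[OF c(1)] c(2)] inj_on_subset[OF inj sub]
      by (intro comp_inj_on)
  qed
  have near: "displacement (snd c \<circ> p) v r \<simeq>\<^sub>S displacement (snd c \<circ> p) w s"
    if "good c v r" "cball w s \<subseteq> cball v r" "s > 0" for c v w r s
    by (rule displacement_homotopic[OF convex_cball cont injc]) (use that in \<open>auto simp: good_def\<close>)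
  \<comment> \<open>Near \<open>v\<close> the lift of \<open>d\<close> is the transition map after
    the lift of \<open>c\<close>, and the transition map has the class of the identity.\<close>
  have change: "displacement (snd c \<circ> p) v r \<simeq>\<^sub>S displacement (snd d \<circ> p) v s"
    if c: "good c v r" and d: "good d v s" for c d v r s
  proof -
    let ?g = "snd c \<circ> p" and ?T = "transition_map c d"
    have cA: "c \<in> \<A>" "d \<in> \<A>" and pos: "r > 0" "s > 0"
      and sub: "p ` cball v r \<subseteq> fst c" "p ` cball v s \<subseteq> fst d"
      using c d by (auto simp: good_def)
    have T: "symplectic_homeomorphism (snd c ` (fst c \<inter> fst d)) (snd d ` (fst c \<inter> fst d)) ?T"
      using A cA by (auto simp: topological_symplectic_structure_def)
    then obtain T' where hT: "homeomorphism (snd c ` (fst c \<inter> fst d)) (snd d ` (fst c \<inter> fst d)) ?T T'"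
      and "open (snd c ` (fst c \<inter> fst d))"
      by (auto simp: symplectic_homeomorphism_def)
    moreover have "p v \<in> fst c" "p v \<in> fst d" using sub pos by (auto simp: image_subset_iff)
    then have "?g v \<in> snd c ` (fst c \<inter> fst d)" by auto
    ultimately obtain R where R: "R > 0" "cball (?g v) R \<subseteq> snd c ` (fst c \<inter> fst d)"
      using open_contains_cball by blast
    have TR: "continuous_on (cball (?g v) R) ?T" "inj_on ?T (cball (?g v) R)"
    proof -
      have "continuous_on (snd c ` (fst c \<inter> fst d)) ?T" "inj_on ?T (snd c ` (fst c \<inter> fst d))"
        using hT by (auto simp: homeomorphism_def intro: inj_on_inverseI)
      then show "continuous_on (cball (?g v) R) ?T" "inj_on ?T (cball (?g v) R)"
        using R(2) continuous_on_subset inj_on_subset by blast+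
    qed
    have "continuous (at v) ?g"
      using continuous_on_interior[OF cont[OF c], of v] pos by simp
    then obtain \<epsilon> where \<epsilon>: "\<epsilon> > 0" "\<And>y. dist y v < \<epsilon> \<Longrightarrow> dist (?g y) (?g v) < R"
      using R(1) unfolding continuous_at_eps_delta by blast
    \<comment> \<open>Both lifts are defined on this ball, and the lift of \<open>c\<close> maps it
      into the ball of radius \<open>R\<close> where the transition map is controlled.\<close>
    define t where "t = min (min r s) (\<epsilon> / 2)"
    have t: "t > 0" "t \<le> r" "t \<le> s" "t < \<epsilon>" using pos \<epsilon>(1) by (auto simp: t_def)
    have sub_t: "cball v t \<subseteq> cball v r" "cball v t \<subseteq> cball v s" using t by auto
    have "good c v t" using c t by (auto simp: good_def)
    note gt = cont[OF this] injc[OF this]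
    have im: "?g ` cball v t \<subseteq> cball (?g v) R"
    proof (rule image_subsetI)
      fix y assume "y \<in> cball v t"
      then show "?g y \<in> cball (?g v) R" using \<epsilon>(2)[of y] t(4) by (simp add: dist_commute)
    qed
    have Tg: "(?T \<circ> ?g) w = (snd d \<circ> p) w" if "w \<in> cball v t" for w
    proof -
      have "p w \<in> fst c" using that sub_t sub by blast
      then show ?thesis using chart(3)[OF cA(1)] by (simp add: transition_map_def)
    qed
    have "displacement ?g v r \<simeq>\<^sub>S displacement ?g v t" by (rule near[OF c sub_t(1) t(1)])
    also have "\<dots> \<simeq>\<^sub>S displacement (snd d \<circ> p) v t"
    proof -
      have "displacement (?T \<circ> ?g) v t u = displacement (snd d \<circ> p) v t u" if "norm u = 1" for u
      proof -
        have "v + t *\<^sub>R u \<in> cball v t" "v \<in> cball v t"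
          using that t(1) scale_in_cball[of u t v] by simp_all
        then show ?thesis unfolding displacement_def by (simp only: Tg)
      qed
      moreover have "displacement (?T \<circ> ?g) v t \<simeq>\<^sub>S displacement ?g v t"
        by (rule displacement_compose_id[OF gt t(1) TR im R(1) order_refl])
          (rule symplectic_homeomorphism_displacement[OF T R(2,1)])
      then have "displacement ?g v t \<simeq>\<^sub>S displacement (?T \<circ> ?g) v t"
        by (rule homotopic_with_symD)
      ultimately show ?thesis
        by (elim homotopic_with_eq) auto
    qed
    also have "\<dots> \<simeq>\<^sub>S displacement (snd d \<circ> p) v s"
      by (subst homotopic_with_sym) (rule near[OF d sub_t(2) t(1)])
    finally show ?thesis .
  qed
  \<comment> \<open>Quantifying over all lifts makes this a relation between points; transitivity
    uses that some lift exists at the middle point.\<close>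
  define R where "R = (\<lambda>v w. \<forall>c d r s. good c v r \<longrightarrow> good d w s \<longrightarrow>
      displacement (snd c \<circ> p) v r \<simeq>\<^sub>S displacement (snd d \<circ> p) w s)"
  have "R v w" for v w
  proof (rule connected_equivalence_relation[where R = R and S = UNIV])
    show "R y x" if "R x y" for x y
      using that unfolding R_def by (meson homotopic_with_sym)
    show "R x z" if "R x y" "R y z" for x y z
      using that ex_good[of y] unfolding R_def by (meson homotopic_with_trans)
    fix a
    obtain c r where c: "good c a r" using ex_good by blast
    have "R a w" if w: "w \<in> ball a r" for w
      unfolding R_def
    proof (intro allI impI)
      fix c' d r' s assume c': "good c' a r'" and d: "good d w s"
      obtain t where t: "t > 0" "cball w t \<subseteq> cball a r"
        using w open_contains_cball[of "ball a r"] ball_subset_cball by (meson open_ball subset_trans)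
      \<comment> \<open>This keeps the new radius below \<open>\<delta>\<close>, so that
        \<open>c\<close> is also a lift around \<open>w\<close> and links the charts at
        \<open>a\<close> and \<open>w\<close>.\<close>
      have "t \<le> r"
        using t cball_subset_cball_iff[of w t a r] by (smt (verit) zero_le_dist)
      then have cw: "good c w t" using c t by (auto simp: good_def)
      have "displacement (snd c' \<circ> p) a r' \<simeq>\<^sub>S displacement (snd c \<circ> p) a r" by (rule change[OF c' c])
      also have "\<dots> \<simeq>\<^sub>S displacement (snd c \<circ> p) w t" by (rule near[OF c t(2,1)])
      also have "\<dots> \<simeq>\<^sub>S displacement (snd d \<circ> p) w s" by (rule change[OF cw d])
      finally show "displacement (snd c' \<circ> p) a r' \<simeq>\<^sub>S displacement (snd d \<circ> p) w s" .
    qed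
    moreover have "r > 0" using c by (simp add: good_def)
    ultimately show "\<exists>T. openin (top_of_set UNIV) T \<and> a \<in> T \<and> (\<forall>x\<in>T. R a x)"
      by (intro exI[of _ "ball a r"]) auto
  qed auto
  note R = this[unfolded R_def, rule_format]
  obtain c r where c: "good c 0 r" using ex_good by blast
  note [simp] = norm_reflect[OF norm_Basis[OF e]] reflect_reflect[OF norm_Basis[OF e]]
  have shift: "p (b + w) = p (reflect e w)" for w
    using deck[of "reflect e w"] by (simp add: add.commute)
  \<comment> \<open>The deck transformation carries the ball around \<open>0\<close> to the ball
    around \<open>b\<close> without changing \<open>p\<close>, so one chart and one radius serve at
    both points.\<close>
  have "p ` cball b r \<subseteq> p ` cball 0 r"
  proof (rule image_subsetI)
    fix w assume "w \<in> cball b r"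
    then have "reflect e (w - b) \<in> cball 0 r" by (simp add: dist_norm norm_minus_commute)
    moreover have "p w = p (reflect e (w - b))" using shift[of "w - b"] by simp
    ultimately show "p w \<in> p ` cball 0 r" by blast
  qed
  then have "good c b r" using c by (auto simp: good_def)
  from R[OF c this]
  have "displacement (snd c \<circ> p) 0 r \<simeq>\<^sub>S displacement (snd c \<circ> p) b r" .
  also have "displacement (snd c \<circ> p) b r = displacement (snd c \<circ> p) 0 r \<circ> reflect e"
    using shift[of 0] shift
    by (simp add: displacement_def fun_eq_iff linear_0[OF linear_reflect] linear_cmul[OF linear_reflect])
  finally have "displacement (snd c \<circ> p) 0 r \<simeq>\<^sub>S displacement (snd c \<circ> p) 0 r \<circ> reflect e" .
  moreover have "r > 0" using c by (simp add: good_def)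
  ultimately show False
    using displacement_not_homotopic_reflected[OF cont[OF c] injc[OF c] _ e] by blast
qed

section \<open>The product of the Klein bottle and a torus\<close>

text \<open>Coordinates 2 to 4 are the parts of \<open>(cos b, e\<^sup>i\<^sup>a sin b)\<close>; they depend on \<open>a\<close> only up to
  \<open>(a, b) \<mapsto> (a + \<pi>, - b)\<close>, the deck transformation of the Klein bottle.\<close>

definition klein_torus_map :: "(real^2) \<times> (real^2) \<Rightarrow> nat \<Rightarrow> real" where
  "klein_torus_map v = (\<lambda>_. 0)
     (0 := cos (2 * fst v $ 1), 1 := sin (2 * fst v $ 1), 2 := cos (fst v $ 2),
      3 := cos (fst v $ 1) * sin (fst v $ 2), 4 := sin (fst v $ 1) * sin (fst v $ 2),
      5 := cos (snd v $ 1), 6 := sin (snd v $ 1), 7 := cos (snd v $ 2), 8 := sin (snd v $ 2))"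

lemma continuous_on_klein_torus_map: "continuous_on UNIV klein_torus_map"
proof (rule continuous_on_coordinatewise_then_product)
  \<comment> \<open>Unfolding the updates leaves case distinctions on the index, which do not depend
    on \<open>v\<close>.\<close>
  have if_const: "continuous_on UNIV (\<lambda>v. if c then f v else g v)"
    if "continuous_on UNIV f" "continuous_on UNIV g" for c and f g :: "(real^2) \<times> (real^2) \<Rightarrow> real"
    using that by (cases c) auto
  show "continuous_on UNIV (\<lambda>v. klein_torus_map v i)" for i
    unfolding klein_torus_map_def fun_upd_apply by (intro if_const continuous_intros)
qed

text \<open>The deck group of the universal cover, listed by four integers; the translation by
  \<open>pi * i\<close> flips the second coordinate exactly for odd \<open>i\<close>.\<close>

definition klein_torus_deck :: "int \<Rightarrow> int \<Rightarrow> int \<Rightarrow> int \<Rightarrow> (real^2) \<times> (real^2) \<Rightarrow> (real^2) \<times> (real^2)" where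
  "klein_torus_deck i j k l v =
     (vector [fst v $ 1 + pi * i, (if even i then 1 else - 1) * fst v $ 2 + 2 * pi * j],
      vector [snd v $ 1 + 2 * pi * k, snd v $ 2 + 2 * pi * l])"

lemma continuous_on_klein_torus_deck: "continuous_on UNIV (klein_torus_deck i j k l)"
proof -
  have "continuous_on UNIV (\<lambda>v. vector [f v, g v] :: real^2)"
    if "continuous_on UNIV f" "continuous_on UNIV g" for f g :: "(real^2) \<times> (real^2) \<Rightarrow> real"
  proof -
    have "(\<lambda>v. vector [f v, g v] :: real^2) = (\<lambda>v. f v *\<^sub>R axis 1 1 + g v *\<^sub>R axis 2 1)"
      by (simp add: fun_eq_iff vec_eq_iff forall_2 axis_def)
    then show ?thesis
      by (simp only:) (intro continuous_intros that)
  qed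
  note this[continuous_intros]
  show ?thesis
    unfolding klein_torus_deck_def[abs_def] by (intro continuous_intros)
qed

lemma real2_pair_eq_iff: "v = w \<longleftrightarrow> fst v $ 1 = fst w $ 1 \<and> fst v $ 2 = fst w $ 2
    \<and> snd v $ 1 = snd w $ 1 \<and> snd v $ 2 = snd w $ 2" for v w :: "(real^2) \<times> (real^2)"
  by (auto simp: prod_eq_iff vec_eq_iff forall_2)

text \<open>The fibres are the deck orbits. Coordinates 0 and 1 fix the first angle up to
  \<open>pi * i\<close>; the parity of \<open>i\<close> then gives the sign with which coordinates 2
  to 4 fix the second angle modulo \<open>2 * pi\<close>.\<close>

lemma klein_torus_map_eq_iff:
  "klein_torus_map v = klein_torus_map w \<longleftrightarrow> (\<exists>i j k l. w = klein_torus_deck i j k l v)"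
proof
  assume eq: "klein_torus_map v = klein_torus_map w"
  have period: "\<exists>n::int. y = x + 2 * pi * n" if "cos x = cos y" "sin x = sin y" for x y :: real
    using sin_cos_eq_iff[of y x] that by auto
  have E: "klein_torus_map v m = klein_torus_map w m" for m using eq by simp
  have a: "cos (2 * fst v $ 1) = cos (2 * fst w $ 1)" "sin (2 * fst v $ 1) = sin (2 * fst w $ 1)"
    using E[of 0] E[of 1] by (simp_all add: klein_torus_map_def)
  obtain i :: int where "2 * fst w $ 1 = 2 * fst v $ 1 + 2 * pi * i"
    using period[OF a] by blast
  then have i: "fst w $ 1 = fst v $ 1 + pi * i" by simp
  define \<sigma> :: real where "\<sigma> = (if even i then 1 else - 1)"
  have "sin (pi * i) = 0" "cos (pi * i) = \<sigma>"
    by (simp_all add: \<sigma>_def)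
  then have ai: "cos (fst w $ 1) = \<sigma> * cos (fst v $ 1)" "sin (fst w $ 1) = \<sigma> * sin (fst v $ 1)"
    unfolding i by (simp_all add: sin_add cos_add)
  have \<sigma>\<sigma>: "\<sigma> * \<sigma> = 1" by (simp add: \<sigma>_def)
  have b: "cos (fst v $ 2) = cos (fst w $ 2)"
    "cos (fst v $ 1) * sin (fst v $ 2) = cos (fst w $ 1) * sin (fst w $ 2)"
    "sin (fst v $ 1) * sin (fst v $ 2) = sin (fst w $ 1) * sin (fst w $ 2)"
    using E[of 2] E[of 3] E[of 4] by (simp_all add: klein_torus_map_def)
  \<comment> \<open>Cosine and sine of one angle do not vanish together, so the common factor is
    0.\<close>
  have "cos (fst v $ 1) * (sin (fst v $ 2) - \<sigma> * sin (fst w $ 2)) = 0"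
       "sin (fst v $ 1) * (sin (fst v $ 2) - \<sigma> * sin (fst w $ 2)) = 0"
    using b(2,3) by (simp_all add: ai algebra_simps)
  then have "sin (fst v $ 2) = \<sigma> * sin (fst w $ 2)"
    using sin_zero_norm_cos_one[of "fst v $ 1"] by auto
  then have "sin (fst w $ 2) = sin (\<sigma> * fst v $ 2)" "cos (fst w $ 2) = cos (\<sigma> * fst v $ 2)"
    using b(1) by (simp_all add: \<sigma>_def)
  then obtain j :: int where j: "fst w $ 2 = \<sigma> * fst v $ 2 + 2 * pi * j"
    using period[of "\<sigma> * fst v $ 2" "fst w $ 2"] by auto
  obtain k :: int where k: "snd w $ 1 = snd v $ 1 + 2 * pi * k"
    using period[of "snd v $ 1" "snd w $ 1"] E[of 5] E[of 6] by (auto simp: klein_torus_map_def)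
  obtain l :: int where l: "snd w $ 2 = snd v $ 2 + 2 * pi * l"
    using period[of "snd v $ 2" "snd w $ 2"] E[of 7] E[of 8] by (auto simp: klein_torus_map_def)
  have "w = klein_torus_deck i j k l v"
    unfolding real2_pair_eq_iff by (simp add: klein_torus_deck_def i j k l \<sigma>_def)
  then show "\<exists>i j k l. w = klein_torus_deck i j k l v" by blast
next
  assume "\<exists>i j k l. w = klein_torus_deck i j k l v"
  then obtain i j k l where w: "w = klein_torus_deck i j k l v" by blast
  have period: "cos (x + 2 * pi * n) = cos x" "sin (x + 2 * pi * n) = sin x" for x :: real and n :: int
    using sin_cos_eq_iff[of "x + 2 * pi * n" x] by auto
  define \<sigma> :: real where "\<sigma> = (if even i then 1 else - 1)"
  have "sin (pi * i) = 0" "cos (pi * i) = \<sigma>"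
    by (simp_all add: \<sigma>_def)
  then have "cos (fst v $ 1 + pi * i) = \<sigma> * cos (fst v $ 1)" "sin (fst v $ 1 + pi * i) = \<sigma> * sin (fst v $ 1)"
    by (simp_all add: sin_add cos_add)
  moreover have "cos (\<sigma> * x) = cos x" "sin (\<sigma> * x) = \<sigma> * sin x" for x by (simp_all add: \<sigma>_def)
  moreover have "2 * (fst v $ 1 + pi * i) = 2 * fst v $ 1 + 2 * pi * i" by (simp add: algebra_simps)
  \<comment> \<open>In coordinates 3 and 4 the signs coming from the two angles cancel.\<close>
  moreover have "\<sigma> * x * (\<sigma> * y) = x * y" for x y by (simp add: \<sigma>_def)
  ultimately show "klein_torus_map v = klein_torus_map w"
    unfolding w klein_torus_deck_def \<sigma>_def[symmetric] klein_torus_map_def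
    by (simp only: fst_conv snd_conv vector_2 period)
qed

text \<open>Points of a ball of radius 1 are at distance at most 2, less than the least nonzero
  shift \<open>pi\<close>.\<close>

lemma inj_on_klein_torus_map: "inj_on klein_torus_map (cball x 1)"
proof (rule inj_onI)
  fix v w assume vw: "v \<in> cball x 1" "w \<in> cball x 1" and "klein_torus_map v = klein_torus_map w"
  then obtain i j k l where w: "w = klein_torus_deck i j k l v" by (auto simp: klein_torus_map_eq_iff)
  have "dist w v \<le> 2" using vw dist_triangle[of w v x] by (simp add: dist_commute)
  then have "norm (fst w - fst v) \<le> 2" "norm (snd w - snd v) \<le> 2"
    using norm_fst_le[of "fst w - fst v" "snd w - snd v"] norm_snd_le[of "snd w - snd v" "fst w - fst v"]
    by (auto simp: dist_norm minus_prod_def split: prod.splits)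
  then have close: "\<bar>fst w $ m - fst v $ m\<bar> \<le> 2" "\<bar>snd w $ m - snd v $ m\<bar> \<le> 2" for m
    using component_le_norm_cart[of "fst w - fst v" m] component_le_norm_cart[of "snd w - snd v" m]
    by simp_all
  have int0: "n = 0" if "\<bar>c * real_of_int n\<bar> \<le> 2" "c \<ge> pi" for c and n :: int
  proof (rule ccontr)
    assume "n \<noteq> 0"
    then have "\<bar>real_of_int n\<bar> \<ge> 1" by linarith
    then have "c * 1 \<le> c * \<bar>real_of_int n\<bar>" using that(2) pi_gt3 by (intro mult_left_mono) auto
    with that pi_gt3 show False by (simp add: abs_mult)
  qed
  \<comment> \<open>This comes first: only with \<open>i\<close> even is the second coordinate
    shifted without a change of sign.\<close>
  have i: "i = 0" using close(1)[of 1] int0[of pi i] by (simp add: w klein_torus_deck_def)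
  moreover have "j = 0" using close(1)[of 2] int0[of "2 * pi" j] by (simp add: w klein_torus_deck_def i)
  moreover have "k = 0" using close(2)[of 1] int0[of "2 * pi" k] by (simp add: w klein_torus_deck_def)
  moreover have "l = 0" using close(2)[of 2] int0[of "2 * pi" l] by (simp add: w klein_torus_deck_def)
  ultimately show "v = w" by (subst real2_pair_eq_iff) (simp add: w klein_torus_deck_def)
qed

text \<open>Every orbit meets one fixed compact set. The radius 8 bounds the sum of two coordinates
  of absolute value at most \<open>pi < 4\<close>.\<close>

lemma klein_torus_fundamental_domain:
  obtains i j k l where "klein_torus_deck i j k l v \<in> cball 0 8 \<times> cball 0 8"
proof -
  have shift: "\<exists>n::int. \<bar>x + 2 * pi * n\<bar> \<le> pi" for x :: real
  proof -
    let ?n = "- round (x / (2 * pi))"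
    have "\<bar>real_of_int (round (x / (2 * pi))) - x / (2 * pi)\<bar> \<le> 1 / 2" by (rule of_int_round_abs_le)
    then have "2 * pi * \<bar>real_of_int (round (x / (2 * pi))) - x / (2 * pi)\<bar> \<le> 2 * pi * (1 / 2)"
      by (intro mult_left_mono) auto
    also have "2 * pi * \<bar>real_of_int (round (x / (2 * pi))) - x / (2 * pi)\<bar>
        = \<bar>2 * pi * (real_of_int (round (x / (2 * pi))) - x / (2 * pi))\<bar>" by (simp add: abs_mult)
    also have "2 * pi * (real_of_int (round (x / (2 * pi))) - x / (2 * pi)) = - (x + 2 * pi * ?n)"
      by (simp add: algebra_simps)
    finally have "\<bar>x + 2 * pi * ?n\<bar> \<le> pi" by (simp only: abs_minus_cancel)
    then show ?thesis by blast
  qed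
  obtain i :: int where i: "\<bar>fst v $ 1 + 2 * pi * i\<bar> \<le> pi" using shift by blast
  obtain j :: int where j: "\<bar>fst v $ 2 + 2 * pi * j\<bar> \<le> pi" using shift by blast
  obtain k :: int where k: "\<bar>snd v $ 1 + 2 * pi * k\<bar> \<le> pi" using shift by blast
  obtain l :: int where l: "\<bar>snd v $ 2 + 2 * pi * l\<bar> \<le> pi" using shift by blast
  have small: "norm x \<le> 8" if "\<bar>x $ 1\<bar> \<le> pi" "\<bar>x $ 2\<bar> \<le> pi" for x :: "real^2"
    using norm_le_l1_cart[of x] that pi_less_4 by (simp add: sum_2)
  \<comment> \<open>The even index \<open>2 * i\<close> avoids the flip, so all four coordinates are
    reduced independently modulo \<open>2 * pi\<close>.\<close>
  have "klein_torus_deck (2 * i) j k l v \<in> cball 0 8 \<times> cball 0 8"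
    using i j k l by (auto simp: klein_torus_deck_def algebra_simps intro!: small)
  then show thesis by (rule that)
qed

section \<open>The image as a closed 4-manifold\<close>

text \<open>\<open>C\<close> is the complement of the union of all translates of \<open>U\<close>,
  closed and saturated. The complement of the image of \<open>U\<close> is the image of the compact
  set \<open>?K \<inter> C\<close>, hence closed.\<close>

lemma openin_klein_torus_map:
  assumes "open U"
  shows "openin (top_of_set (range klein_torus_map)) (klein_torus_map ` U)"
proof -
  let ?K = "cball 0 8 \<times> cball 0 8 :: ((real^2) \<times> (real^2)) set"
  define C where "C = - (\<Union>i j k l. klein_torus_deck i j k l -` U)"
  have "open (klein_torus_deck i j k l -` U)" for i j k l
    using continuous_on_klein_torus_deck assms by (simp add: continuous_on_open_vimage)
  then have "closed C" unfolding C_def by (intro closed_Compl open_UN ballI)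
  have mem: "klein_torus_map v \<in> klein_torus_map ` U \<longleftrightarrow> v \<notin> C" for v
    by (simp only: C_def image_iff klein_torus_map_eq_iff) blast
  have "range klein_torus_map - klein_torus_map ` U = klein_torus_map ` (?K \<inter> C)"
  proof (intro equalityI subsetI)
    fix y assume "y \<in> range klein_torus_map - klein_torus_map ` U"
    then obtain v where v: "y = klein_torus_map v" "y \<notin> klein_torus_map ` U" by blast
    obtain i j k l where K: "klein_torus_deck i j k l v \<in> ?K" by (rule klein_torus_fundamental_domain)
    have y: "y = klein_torus_map (klein_torus_deck i j k l v)"
      unfolding v(1) klein_torus_map_eq_iff by blast
    then have "klein_torus_deck i j k l v \<in> C"
      using v(2) mem[of "klein_torus_deck i j k l v"] by simp
    with K y show "y \<in> klein_torus_map ` (?K \<inter> C)" by (intro image_eqI IntI)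
  next
    fix y assume "y \<in> klein_torus_map ` (?K \<inter> C)"
    then obtain v where "y = klein_torus_map v" "v \<in> C" by blast
    then show "y \<in> range klein_torus_map - klein_torus_map ` U"
      using mem[of v] by simp
  qed
  moreover have "compact (?K \<inter> C)"
    using \<open>closed C\<close> by (intro compact_Int_closed compact_Times compact_cball)
  then have "compact (klein_torus_map ` (?K \<inter> C))"
    using compact_continuous_image[OF continuous_on_subset[OF continuous_on_klein_torus_map subset_UNIV]] by blast
  ultimately have "closed (range klein_torus_map - klein_torus_map ` U)"
    by (simp add: compact_imp_closed)
  moreover have "klein_torus_map ` U = range klein_torus_map - (range klein_torus_map - klein_torus_map ` U)"
    by blast
  ultimately show ?thesis
    by (metis Diff_subset closed_subset openin_diff openin_subtopology_self)
qed

lemma second_countable_euclidean: "second_countable (euclidean :: 'a::second_countable_topology topology)"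
proof -
  obtain B :: "'a set set" where "countable B" "\<And>C. C \<in> B \<Longrightarrow> open C"
    and "\<And>S. open S \<Longrightarrow> \<exists>U. U \<subseteq> B \<and> S = \<Union>U"
    using univ_second_countable by blast
  then show ?thesis
    unfolding second_countable_def by (intro exI[of _ B]) (simp, blast)
qed

text \<open>An injective open continuous map on a unit ball is a homeomorphism onto its image; a
  linear model of dimension 4 is then exchanged for \<open>Euclidean_space 4\<close>.\<close>

lemma klein_torus_locally_Euclidean:
  assumes "x \<in> range klein_torus_map"
  shows "\<exists>U V. openin (top_of_set (range klein_torus_map)) U \<and> x \<in> U \<and> openin (Euclidean_space 4) V \<and>
    subtopology (top_of_set (range klein_torus_map)) U homeomorphic_space subtopology (Euclidean_space 4) V"
proof -
  obtain v where v: "x = klein_torus_map v" using assms by blast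
  let ?B = "ball v 1" and ?X = "top_of_set (range klein_torus_map)"
  have inj: "inj_on klein_torus_map ?B"
    by (rule inj_on_subset[OF inj_on_klein_torus_map ball_subset_cball])
  have openB: "openin ?X (klein_torus_map ` ?B)"
    by (rule openin_klein_torus_map) simp
  obtain q where "homeomorphism ?B (klein_torus_map ` ?B) klein_torus_map q"
  proof (rule homeomorphism_injective_open_map[OF continuous_on_subset[OF continuous_on_klein_torus_map] refl inj])
    fix W assume "openin (top_of_set ?B) W"
    then have "open W" "W \<subseteq> ?B" by (simp_all add: openin_open_eq)
    then show "openin (top_of_set (klein_torus_map ` ?B)) (klein_torus_map ` W)"
      by (intro openin_subset_trans[OF openin_klein_torus_map]) auto
  qed auto
  then have "top_of_set ?B homeomorphic_space top_of_set (klein_torus_map ` ?B)"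
    unfolding homeomorphic_space_def by (metis homeomorphic_maps_iff_homeomorphism)
  then have 1: "top_of_set (klein_torus_map ` ?B) homeomorphic_space top_of_set ?B"
    by (subst homeomorphic_space_sym)
  have 2: "subtopology ?X (klein_torus_map ` ?B) = top_of_set (klein_torus_map ` ?B)"
    by (simp add: subtopology_subtopology Int_absorb1 image_mono)
  obtain f :: "(nat \<Rightarrow> real) \<Rightarrow> (real^2) \<times> (real^2)" and g
    where fg: "homeomorphic_maps (Euclidean_space 4) euclidean f g"
    using homeomorphic_maps_Euclidean_space_euclidean[where 'n = "(real^2) \<times> (real^2)"] by auto
  then have g: "homeomorphic_map euclidean (Euclidean_space 4) g"
    using homeomorphic_maps_map homeomorphic_maps_sym by blast
  then have openV: "openin (Euclidean_space 4) (g ` ?B)"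
    by (simp add: homeomorphic_map_openness)
  have "homeomorphic_map (top_of_set ?B) (subtopology (Euclidean_space 4) (g ` ?B)) g"
    using homeomorphic_map_subtopologies[OF g, of ?B "g ` ?B"] homeomorphic_imp_surjective_map[OF g]
    by auto
  then have "subtopology ?X (klein_torus_map ` ?B) homeomorphic_space subtopology (Euclidean_space 4) (g ` ?B)"
    unfolding 2 by (intro homeomorphic_space_trans[OF 1] homeomorphic_map_imp_homeomorphic_space)
  moreover have "x \<in> klein_torus_map ` ?B" unfolding v by (intro imageI) simp
  ultimately show ?thesis using openB openV by blast
qed

lemma closed_manifold_klein_torus: "closed_manifold 4 (top_of_set (range klein_torus_map))"
proof -
  let ?K = "cball 0 8 \<times> cball 0 8 :: ((real^2) \<times> (real^2)) set"
  \<comment> \<open>Compactness follows because the compact set meeting every orbit already maps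
    onto the whole range.\<close>
  have "range klein_torus_map = klein_torus_map ` ?K"
  proof (intro equalityI image_subsetI)
    fix v
    obtain i j k l where K: "klein_torus_deck i j k l v \<in> ?K" by (rule klein_torus_fundamental_domain)
    have "klein_torus_map v = klein_torus_map (klein_torus_deck i j k l v)"
      unfolding klein_torus_map_eq_iff by blast
    then show "klein_torus_map v \<in> klein_torus_map ` ?K" using K by (rule image_eqI)
  qed auto
  moreover have "compact (klein_torus_map ` ?K)"
    by (rule compact_continuous_image[OF continuous_on_subset[OF continuous_on_klein_torus_map]])
      (auto intro: compact_Times)
  ultimately have "compact (range klein_torus_map)" by simp
  then have "compact_space (top_of_set (range klein_torus_map))"
    by (simp add: compact_space_subtopology)
  then show ?thesis
    unfolding closed_manifold_def topological_manifold_def topspace_euclidean_subtopology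
    by (intro conjI ballI klein_torus_locally_Euclidean second_countable_subtopology
        second_countable_euclidean Hausdorff_space_subtopology Hausdorff_space_euclidean)
qed

theorem corollary1p2:
  shows "\<exists>X :: (nat \<Rightarrow> real) topology.
           closed_manifold 4 X \<and>
           \<not> (\<exists>\<A> :: ((nat \<Rightarrow> real) set \<times> ((nat \<Rightarrow> real) \<Rightarrow> (real^2) \<times> (real^2))) set.
                topological_symplectic_structure X \<A>)"
proof (intro exI conjI notI)
  show "closed_manifold 4 (top_of_set (range klein_torus_map))" by (rule closed_manifold_klein_torus)
next
  assume "\<exists>\<A> :: ((nat \<Rightarrow> real) set \<times> ((nat \<Rightarrow> real) \<Rightarrow> (real^2) \<times> (real^2))) set.
    topological_symplectic_structure (top_of_set (range klein_torus_map)) \<A>"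
  moreover have "(axis 2 1 :: real^2, 0 :: real^2) \<in> Basis"
    by (simp add: Basis_prod_def axis_in_Basis_iff)
  moreover have "klein_torus_map (reflect (axis 2 1, 0) v + (axis 1 pi, 0)) = klein_torus_map v" for v
  proof -
    \<comment> \<open>Reversing the second Klein bottle angle and shifting the first by
      \<open>pi\<close> is the orientation-reversing generator of the deck group.\<close>
    have "reflect (axis 2 1, 0) v + (axis 1 pi, 0) = klein_torus_deck 1 0 0 0 v"
      by (subst real2_pair_eq_iff)
        (simp add: reflect_def klein_torus_deck_def inner_prod_def inner_vec_def sum_2 axis_def)
    then show ?thesis by (metis klein_torus_map_eq_iff)
  qed
  ultimately show False
    using no_symplectic_structure_orientation_reversing_deck[OF continuous_on_klein_torus_map zero_less_one
        inj_on_klein_torus_map] by blast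
qed

end
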